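(* There is a universal constant $C>0$ such that the following holds. Let $n\ge1$ and let $f,g:[0,1]^n\to\mathbb{R}$ be monotone functions belonging to the class $\mathcal{A}$ (smooth functions with Neumann boundary conditions, see context), with $\|f\|\le1$ and $\|g\|\le1$ in $L^2([0,1]^n,\mathcal{U}^{\otimes n})$, where $\mathcal{U}$ is the uniform measure on $[0,1]$. Then $$\mathbb{E}[fg]-\mathbb{E}[f]\,\mathbb{E}[g]\;\ge\;\frac1C\cdot\Phi\left(\sum_{\#\alpha=1}\hat f(\alpha)\hat g(\alpha)\right),$$ where the sum is over $\alpha\in\mathbb{N}^n$ with $\#\alpha=1$, $\hat f(\alpha),\hat g(\alpha)$ are the coefficients of $f,g$ in the cosine basis, expectations are under $\mathcal{U}^{\otimes n}$, and $\Phi:[0,1]\to[0,1]$ is $\Phi(x)=\min\left\{x,\frac{x}{\log^2(1/x)}\right\}$.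
   Context: $\mathbb{N}=\{0,1,2,\dots\}$. $\langle f,g\rangle=\mathbb{E}_{x\sim\mathcal{U}^{\otimes n}}[f(x)g(x)]$, $\|f\|=\langle f,f\rangle^{1/2}$. A function $f:[0,1]^n\to\mathbb{R}$ is monotone if $f(x)\le f(y)$ whenever $x_i\le y_i$ for all $i\in[n]$. For $n=1$, $\mathcal{A}=\{f\in C^\infty[0,1]:f'(0)=f'(1)=0\}$; for general $n$, $\mathcal{A}$ is the set of $f\in C^\infty([0,1]^n)$ such that for every $i$, $\partial_if(x)=0$ whenever $x_i\in\{0,1\}$. Cosine basis: for $\alpha\in\mathbb{N}^n$, $\varphi_\alpha(x)=\prod_{i:\alpha_i\ne0}\sqrt2\cos(\pi\alpha_ix_i)$ (with $\varphi_{(0,\dots,0)}=1$); this is an orthonormal basis of $L^2([0,1]^n,\mathcal{U}^{\otimes n})$, and $\hat f(\alpha)=\langle f,\varphi_\alpha\rangle$. $\#\alpha=|\{i:\alpha_i\ne0\}|$. Conventions for $\Phi$: $\Phi(0)=0$, $\Phi(1)=1$. The inequality is read as including that the argument of $\Phi$ lies in its domain $[0,1]$. *)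

theory Defs
  imports "HOL-Probability.Probability"
begin

text \<open>
  The dimension \<open>n\<close> is quantified inside the scope of the universal constant, so it cannot
  be a type. Points of \<open>[0,1]^n\<close> are therefore extensional functions on the index set
  \<open>{..<n}\<close>. The topology on \<open>nat \<Rightarrow> real\<close> is the product topology, which induces the
  Euclidean one on the cube.
\<close>

definition cube :: "nat \<Rightarrow> (nat \<Rightarrow> real) set" where
  "cube n = (\<Pi>\<^sub>E i\<in>{..<n}. {0..1})"

text \<open>
  The underlying space is the cube itself rather than all of \<open>\<real>^n\<close>: values of a function
  outside the cube then affect neither its measurability nor its integral.
\<close>

definition unif_cube :: "nat \<Rightarrow> (nat \<Rightarrow> real) measure" where
  "unif_cube n = (\<Pi>\<^sub>M i\<in>{..<n}. restrict_space lborel {0..1})"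

lemma space_unif_cube: "space (unif_cube n) = cube n"
  by (simp add: unif_cube_def cube_def space_PiM space_restrict_space)

lemma prob_space_unif_cube: "prob_space (unif_cube n)"
  unfolding unif_cube_def
  by (intro prob_space_PiM prob_spaceI)
     (simp add: space_restrict_space emeasure_restrict_space)

definition expect :: "nat \<Rightarrow> ((nat \<Rightarrow> real) \<Rightarrow> real) \<Rightarrow> real" where
  "expect n f = (\<integral>x. f x \<partial>unif_cube n)"

definition L2_inner :: "nat \<Rightarrow> ((nat \<Rightarrow> real) \<Rightarrow> real) \<Rightarrow> ((nat \<Rightarrow> real) \<Rightarrow> real) \<Rightarrow> real" where
  "L2_inner n f g = expect n (\<lambda>x. f x * g x)"

definition L2_norm :: "nat \<Rightarrow> ((nat \<Rightarrow> real) \<Rightarrow> real) \<Rightarrow> real" where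
  "L2_norm n f = sqrt (L2_inner n f f)"

definition monotone_cube :: "nat \<Rightarrow> ((nat \<Rightarrow> real) \<Rightarrow> real) \<Rightarrow> bool" where
  "monotone_cube n f \<longleftrightarrow> monotone_on (cube n) (\<lambda>x y. \<forall>i<n. x i \<le> y i) (\<le>) f"

text \<open>
  Partial derivatives on the closed cube are one-sided at the faces. A function is in
  \<open>C^\<infinity>([0,1]^n)\<close> if its iterated partial derivatives of all orders exist and are
  continuous on the closed cube.
\<close>

definition has_partial_derivative ::
  "nat \<Rightarrow> nat \<Rightarrow> ((nat \<Rightarrow> real) \<Rightarrow> real) \<Rightarrow> real \<Rightarrow> (nat \<Rightarrow> real) \<Rightarrow> bool" where
  "has_partial_derivative n i f D x \<longleftrightarrow>
     ((\<lambda>t. f (x(i := t))) has_real_derivative D) (at (x i) within {0..1})"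

primrec C_k_cube :: "nat \<Rightarrow> nat \<Rightarrow> ((nat \<Rightarrow> real) \<Rightarrow> real) \<Rightarrow> bool" where
  "C_k_cube n 0 f \<longleftrightarrow> continuous_on (cube n) f"
| "C_k_cube n (Suc k) f \<longleftrightarrow> continuous_on (cube n) f \<and>
     (\<forall>i<n. \<exists>f'. (\<forall>x\<in>cube n. has_partial_derivative n i f (f' x) x) \<and> C_k_cube n k f')"

definition smooth_cube :: "nat \<Rightarrow> ((nat \<Rightarrow> real) \<Rightarrow> real) \<Rightarrow> bool" where
  "smooth_cube n f \<longleftrightarrow> (\<forall>k. C_k_cube n k f)"

definition neumann_class :: "nat \<Rightarrow> ((nat \<Rightarrow> real) \<Rightarrow> real) set" where
  "neumann_class n = {f. smooth_cube n f \<and>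
     (\<forall>i<n. \<forall>x\<in>cube n. x i \<in> {0, 1} \<longrightarrow> has_partial_derivative n i f 0 x)}"

definition multi_indices :: "nat \<Rightarrow> (nat \<Rightarrow> nat) set" where
  "multi_indices n = (\<Pi>\<^sub>E i\<in>{..<n}. UNIV)"

definition index_support :: "nat \<Rightarrow> (nat \<Rightarrow> nat) \<Rightarrow> nat set" where
  "index_support n \<alpha> = {i. i < n \<and> \<alpha> i \<noteq> 0}"

definition cosine_basis :: "nat \<Rightarrow> (nat \<Rightarrow> nat) \<Rightarrow> (nat \<Rightarrow> real) \<Rightarrow> real" where
  "cosine_basis n \<alpha> x = (\<Prod>i\<in>index_support n \<alpha>. sqrt 2 * cos (pi * real (\<alpha> i) * x i))"

definition cosine_coeff :: "nat \<Rightarrow> ((nat \<Rightarrow> real) \<Rightarrow> real) \<Rightarrow> (nat \<Rightarrow> nat) \<Rightarrow> real" where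
  "cosine_coeff n f \<alpha> = L2_inner n f (cosine_basis n \<alpha>)"

definition level_one :: "nat \<Rightarrow> (nat \<Rightarrow> nat) set" where
  "level_one n = {\<alpha> \<in> multi_indices n. card (index_support n \<alpha>) = 1}"

text \<open>
  The value at \<open>1\<close> has to be set by hand, since \<open>x / 0 = 0\<close> would give \<open>\<Phi>(1) = 0\<close>.
\<close>

definition Phi :: "real \<Rightarrow> real" where
  "Phi x = (if x = 0 then 0 else if x = 1 then 1 else min x (x / (ln (1 / x))\<^sup>2))"

end

theory Submission
  imports Defs
begin

text \<open>
  Let \<open>T\<^sub>r\<close> be the operator that resamples every coordinate independently with probability
  \<open>1 - r\<close>. Then \<open>q(r) = \<langle>T\<^sub>r f, g\<rangle>\<close> is a polynomial \<open>\<Sum>\<^sub>k a\<^sub>k r\<^sup>k\<close> with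
  \<open>a\<^sub>k = \<Sum>\<^bsub>#\<alpha> = k\<^esub> cosine_coeff f \<alpha> * cosine_coeff g \<alpha>\<close>, so that \<open>q(0) = E[f] E[g]\<close>, \<open>q(1) = E[fg]\<close>, the quantity
  of interest is \<open>a\<^sub>1 = q'(0)\<close>, and \<open>\<bar>a\<^sub>k\<bar> \<le> 1\<close> since the norms are at most \<open>1\<close>. Chebyshev's correlation
  inequality, applied coordinate by coordinate, gives \<open>0 \<le> q(r) - q(0) \<le> \<epsilon>\<close> on \<open>[0,1]\<close> with
  \<open>\<epsilon> = E[fg] - E[f] E[g]\<close>. Truncating \<open>q - q(0)\<close> at degree \<open>d\<close> costs at most \<open>2\<^sup>-\<^sup>d\<close> on
  \<open>[0,1/2]\<close>, and Markov's inequality at the endpoint \<open>0\<close> gives \<open>a\<^sub>1 \<le> 8 d\<^sup>2 (\<epsilon> + 2\<^sup>-\<^sup>d)\<close>;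
  then take \<open>d\<close> of order \<open>log (1 / a\<^sub>1)\<close>. Only the Efron-Stein decomposition is needed in dimension
  \<open>n\<close>; the cosine basis enters through Parseval's identity for the one-dimensional marginals.
\<close>

subsection \<open>Markov's inequality at an endpoint\<close>

text \<open>An m-th finite difference annihilates polynomials of degree below m. One factor
  \<open>real j + c\<close> is split off: the \<open>c\<close> part vanishes by induction, and in
  the \<open>j\<close> part absorption, \<open>j * (m choose j) = m * (m - 1 choose j - 1)\<close>,
  lowers m. The resulting index shift turns \<open>c\<close> into \<open>1 + c\<close>, so
  \<open>c\<close> has to be arbitrary in the induction.\<close>

lemma alternating_binomial_sum_power:
  fixes c :: real
  assumes "e < m"
  shows "(\<Sum>j\<le>m. (-1) ^ j * real (m choose j) * (real j + c) ^ e) = 0"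
  using assms
proof (induction e arbitrary: m c)
  case 0
  then show ?case
    using choose_alternating_sum[of m, where 'a = real] by simp
next
  case (Suc e)
  then obtain m' where m: "m = Suc m'" and e: "e < m'"
    by (cases m) auto
  have "(\<Sum>j\<le>m. (-1) ^ j * real (m choose j) * (real j + c) ^ Suc e)
      = (\<Sum>j\<le>m. (-1) ^ j * (real j * real (m choose j)) * (real j + c) ^ e)
        + c * (\<Sum>j\<le>m. (-1) ^ j * real (m choose j) * (real j + c) ^ e)"
    by (simp add: sum_distrib_left algebra_simps flip: sum.distrib)
  also have "(\<Sum>j\<le>m. (-1) ^ j * real (m choose j) * (real j + c) ^ e) = 0"
    using Suc by simp
  also have "(\<Sum>j\<le>m. (-1) ^ j * (real j * real (m choose j)) * (real j + c) ^ e)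
      = (\<Sum>j\<le>m'. (-1) ^ Suc j * (real (Suc j) * real (m choose Suc j)) * (real (Suc j) + c) ^ e)"
    unfolding m by (subst sum.atMost_Suc_shift) simp
  also have "\<dots> = (\<Sum>j\<le>m'. - real m * ((-1) ^ j * real (m' choose j) * (real j + (1 + c)) ^ e))"
  proof (rule sum.cong)
    fix j
    have "real (Suc j) * real (m choose Suc j) = real m * real (m' choose j)"
      unfolding m by (metis Suc_times_binomial of_nat_mult)
    then show "(-1) ^ Suc j * (real (Suc j) * real (m choose Suc j)) * (real (Suc j) + c) ^ e
        = - real m * ((-1) ^ j * real (m' choose j) * (real j + (1 + c)) ^ e)"
      by (simp add: algebra_simps)
  qed simp
  also have "\<dots> = 0"
    unfolding sum_distrib_left[symmetric] using Suc.IH[OF e, of "1 + c"] by simp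
  finally show ?case by simp
qed

text \<open>The preceding identity for order \<open>2 * d\<close>, exponent \<open>2 * k\<close> and
  centre \<open>- d\<close>, folded about \<open>i = d\<close>: the terms at \<open>d - j\<close>
  and \<open>d + j\<close> agree.\<close>

lemma symmetric_alternating_binomial_sum:
  assumes "k < d"
  shows "2 * (\<Sum>j = 1..d. (-1) ^ (j - 1) * real ((2 * d) choose (d + j)) * (real j ^ 2) ^ k)
    = (if k = 0 then real ((2 * d) choose d) else 0)"
proof -
  define T where "T i = (-1) ^ i * real ((2 * d) choose i) * (real i + - real d) ^ (2 * k)" for i
  have split: "{..2 * d} = {..<d} \<union> {d} \<union> {d<..2 * d}" by auto
  have "0 = (\<Sum>i\<le>2 * d. T i)"
    unfolding T_def using alternating_binomial_sum_power[of "2 * k" "2 * d" "- real d"] assms by simp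
  also have "\<dots> = (\<Sum>i<d. T i) + T d + (\<Sum>i\<in>{d<..2 * d}. T i)"
    unfolding split by (subst sum.union_disjoint, auto)+
  also have "(\<Sum>i\<in>{d<..2 * d}. T i) = (\<Sum>j = 1..d. T (d + j))"
    by (rule sum.reindex_bij_witness[of _ "\<lambda>j. d + j" "\<lambda>i. i - d"]) auto
  also have "(\<Sum>i<d. T i) = (\<Sum>j = 1..d. T (d - j))"
    by (rule sum.reindex_bij_witness[of _ "\<lambda>j. d - j" "\<lambda>i. d - i"]) auto
  also have "(\<Sum>j = 1..d. T (d - j)) = (\<Sum>j = 1..d. T (d + j))"
  proof (rule sum.cong)
    fix j assume j: "j \<in> {1..d}"
    have "(2 * d) choose (d - j) = (2 * d) choose (d + j)"
      using binomial_symmetric[of "d - j" "2 * d"] j by (simp add: algebra_simps)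
    moreover have "(-1 :: real) ^ (d - j) = (-1) ^ (d + j)"
      using j by (simp add: minus_one_power_iff)
    ultimately show "T (d - j) = T (d + j)"
      using j by (simp add: T_def of_nat_diff)
  qed simp
  finally have "2 * (\<Sum>j = 1..d. T (d + j)) = - T d" by simp
  moreover have "T (d + j) = - ((-1) ^ d) * ((-1) ^ (j - 1) * real ((2 * d) choose (d + j)) * (real j ^ 2) ^ k)"
    if "j \<in> {1..d}" for j
    using that by (cases j) (auto simp: T_def power_add power_mult)
  ultimately have "2 * (- ((-1) ^ d)) * (\<Sum>j = 1..d. (-1) ^ (j - 1) * real ((2 * d) choose (d + j)) * (real j ^ 2) ^ k) = - T d"
    by (simp add: sum_distrib_left mult.assoc)
  \<comment> \<open>The central term contains \<open>0 ^ (2 * k)\<close>, which is 1 exactly when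
    \<open>k = 0\<close>.\<close>
  moreover have "T d = (-1) ^ d * (if k = 0 then real ((2 * d) choose d) else 0)"
    by (simp add: T_def)
  ultimately show ?thesis by (cases "even d") auto
qed

lemma sum_inverse_squares_le: "(\<Sum>j = 1..d. 1 / (real j)\<^sup>2) \<le> 2"
proof -
  \<comment> \<open>The extra \<open>- 1 / real d\<close> makes the induction telescope.\<close>
  have "(\<Sum>j = 1..d. 1 / (real j)\<^sup>2) \<le> 2 - 1 / real d" if "d \<ge> 1"
    using that
  proof (induction d rule: dec_induct)
    case (step d)
    have "1 / (real (Suc d))\<^sup>2 \<le> 1 / (real d * real (Suc d))"
      using step by (intro divide_left_mono) (auto simp: power2_eq_square)
    also have "\<dots> = 1 / real d - 1 / real (Suc d)"
      using step by (simp add: field_simps)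
    finally have "1 / (real (Suc d))\<^sup>2 \<le> 1 / real d - 1 / real (Suc d)" .
    then show ?case using step by simp
  qed simp
  then show ?thesis by (cases "d = 0") (auto intro: order_trans)
qed

text \<open>
  Lagrange interpolation at the nodes \<open>j\<^sup>2\<close>: for these nodes the weights that compute the
  derivative at \<open>0\<close> are bounded by \<open>2 / j\<^sup>2\<close>, hence summable uniformly in the degree.
\<close>

lemma derivative_at_0_weights:
  obtains w :: "nat \<Rightarrow> real"
  where "\<And>k. 1 \<le> k \<Longrightarrow> k \<le> d \<Longrightarrow> (\<Sum>j = 1..d. w j * (real j ^ 2) ^ k) = (if k = 1 then 1 else 0)"
    and "(\<Sum>j = 1..d. \<bar>w j\<bar>) \<le> 4"
proof -
  define B where "B j = real ((2 * d) choose (d + j)) / real ((2 * d) choose d)" for j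
  \<comment> \<open>The division by \<open>j\<^sup>2\<close> lowers the exponent from
    \<open>k\<close> to \<open>k - 1\<close>, where
    \<open>symmetric_alternating_binomial_sum\<close> applies; dividing by the central binomial
    coefficient, the largest one, normalises and keeps \<open>B\<close> in [0,1].\<close>
  define w where "w j = 2 * ((-1) ^ (j - 1) * B j) / (real j)\<^sup>2" for j
  have B: "0 \<le> B j" "B j \<le> 1" for j
    using binomial_maximum'[of d "d + j"] by (auto simp: B_def divide_simps)
  show ?thesis
  proof
    fix k assume k: "1 \<le> k" "k \<le> d"
    then obtain k' where k': "k = Suc k'" by (cases k) auto
    have "(\<Sum>j = 1..d. w j * (real j ^ 2) ^ k)
        = 2 * (\<Sum>j = 1..d. (-1) ^ (j - 1) * real ((2 * d) choose (d + j)) * (real j ^ 2) ^ k') / real ((2 * d) choose d)"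
      unfolding sum_distrib_left sum_divide_distrib
      by (intro sum.cong) (auto simp: w_def B_def k' field_simps)
    then show "(\<Sum>j = 1..d. w j * (real j ^ 2) ^ k) = (if k = 1 then 1 else 0)"
      using symmetric_alternating_binomial_sum[of k' d] k k' by simp
  next
    have "(\<Sum>j = 1..d. \<bar>w j\<bar>) \<le> (\<Sum>j = 1..d. 2 * (1 / (real j)\<^sup>2))"
    proof (rule sum_mono)
      fix j
      show "\<bar>w j\<bar> \<le> 2 * (1 / (real j)\<^sup>2)"
        using B[of j] by (auto simp: w_def abs_mult power_abs intro!: divide_right_mono)
    qed
    also have "\<dots> \<le> 4"
      unfolding sum_distrib_left[symmetric] using sum_inverse_squares_le[of d] by simp
    finally show "(\<Sum>j = 1..d. \<bar>w j\<bar>) \<le> 4" .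
  qed
qed

lemma sum_half_powers_tail_le:
  "(\<Sum>k = 1..N. if k \<le> d then 0 else (1 / 2) ^ k) \<le> (1 / 2 :: real) ^ d"
proof -
  \<comment> \<open>The exact remainder of the geometric tail is carried along so that the induction
    on \<open>N\<close> closes.\<close>
  have "(\<Sum>k = 1..N. if k \<le> d then 0 else (1 / 2) ^ k) \<le> (1 / 2 :: real) ^ d - (1 / 2) ^ max d N"
  proof (induction N)
    case (Suc N)
    show ?case
    proof (cases "Suc N \<le> d")
      case True
      then show ?thesis using Suc by (simp add: max_def)
    next
      case False
      then have "max d (Suc N) = Suc N" "max d N = N" by auto
      then show ?thesis using Suc False by simp
    qed
  qed simp
  moreover have "0 \<le> (1 / 2 :: real) ^ max d N" by simp
  ultimately show ?thesis by linarith
qed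

text \<open>The weighted sum of the values at the nodes \<open>j\<^sup>2 / (2 * d\<^sup>2)\<close>
  is evaluated in two ways. Values bounded by \<open>\<epsilon>\<close> give at most
  \<open>4 * \<epsilon>\<close>. Monomial by monomial, degrees up to \<open>d\<close> leave only
  \<open>a 1 / (2 * d\<^sup>2)\<close>, and the higher degrees contribute a geometric tail, so the
  bound is independent of \<open>N\<close>.\<close>

lemma linear_coeff_le:
  fixes a :: "nat \<Rightarrow> real"
  assumes a: "\<And>k. \<bar>a k\<bar> \<le> 1"
    and bound: "\<And>r. 0 \<le> r \<Longrightarrow> r \<le> 1 \<Longrightarrow> \<bar>\<Sum>k = 1..N. a k * r ^ k\<bar> \<le> \<epsilon>"
    and N: "N \<ge> 1" and d: "d \<ge> 1"
  shows "\<bar>a 1\<bar> \<le> 8 * (real d)\<^sup>2 * (\<epsilon> + (1 / 2) ^ d)"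
proof -
  obtain w where w: "\<And>k. 1 \<le> k \<Longrightarrow> k \<le> d \<Longrightarrow> (\<Sum>j = 1..d. w j * (real j ^ 2) ^ k) = (if k = 1 then 1 else 0)"
    and w4: "(\<Sum>j = 1..d. \<bar>w j\<bar>) \<le> 4"
    using derivative_at_0_weights by metis
  \<comment> \<open>The factor 2 confines the nodes to [0,1/2], where powers above \<open>d\<close>
    decay geometrically.\<close>
  define D where "D = 2 * (real d)\<^sup>2"
  have D: "D > 0" using d by (simp add: D_def)
  define r where "r j = (real j)\<^sup>2 / D" for j
  have r: "0 \<le> r j" "r j \<le> 1 / 2" if "j \<in> {1..d}" for j
    using that D by (auto simp: r_def D_def divide_simps power_mono)
  \<comment> \<open>\<open>s k\<close> is the interpolation functional applied to the monomial of
    degree \<open>k\<close>.\<close>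
  define s where "s k = (\<Sum>j = 1..d. w j * r j ^ k)" for k
  have eps: "\<epsilon> \<ge> 0" using bound[of 0] by simp
  have s: "\<bar>s k - (if k = 1 then 1 / D else 0)\<bar> \<le> 4 * (if k \<le> d then 0 else (1 / 2) ^ k)"
    if "k \<in> {1..N}" for k
  proof (cases "k \<le> d")
    case True
    have "s k = (\<Sum>j = 1..d. w j * (real j ^ 2) ^ k) / D ^ k"
      by (simp add: s_def r_def power_divide sum_divide_distrib)
    then show ?thesis using w[of k] True that by simp
  next
    case False
    have "\<bar>s k\<bar> \<le> (\<Sum>j = 1..d. \<bar>w j * r j ^ k\<bar>)"
      unfolding s_def by (rule sum_abs)
    also have "\<dots> \<le> (\<Sum>j = 1..d. \<bar>w j\<bar> * (1 / 2) ^ k)"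
      using r by (auto intro!: sum_mono mult_left_mono power_mono simp: abs_mult power_abs simp del: power_divide)
    also have "\<dots> \<le> 4 * (1 / 2) ^ k"
      unfolding sum_distrib_right[symmetric] using w4 by (intro mult_right_mono) auto
    finally show ?thesis using False d by auto
  qed
  have "\<bar>(\<Sum>k = 1..N. a k * s k) - a 1 / D\<bar>
      = \<bar>\<Sum>k = 1..N. a k * (s k - (if k = 1 then 1 / D else 0))\<bar>"
    using N by (simp add: right_diff_distrib sum_subtractf if_distrib[of "\<lambda>x. _ * x"] sum.delta cong: if_cong)
  also have "\<dots> \<le> (\<Sum>k = 1..N. \<bar>a k * (s k - (if k = 1 then 1 / D else 0))\<bar>)"
    by (rule sum_abs)
  also have "\<dots> \<le> (\<Sum>k = 1..N. 4 * (if k \<le> d then 0 else (1 / 2) ^ k))"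
  proof (rule sum_mono)
    fix k assume k: "k \<in> {1..N}"
    show "\<bar>a k * (s k - (if k = 1 then 1 / D else 0))\<bar> \<le> 4 * (if k \<le> d then 0 else (1 / 2) ^ k)"
      using mult_mono[OF a[of k] s[OF k]] by (simp add: abs_mult)
  qed
  also have "\<dots> \<le> 4 * (1 / 2) ^ d"
    unfolding sum_distrib_left[symmetric] using sum_half_powers_tail_le[where N = N and d = d] by simp
  finally have 1: "\<bar>(\<Sum>k = 1..N. a k * s k) - a 1 / D\<bar> \<le> 4 * (1 / 2) ^ d" .
  have "(\<Sum>k = 1..N. a k * s k) = (\<Sum>j = 1..d. w j * (\<Sum>k = 1..N. a k * r j ^ k))"
    unfolding s_def sum_distrib_left by (subst sum.swap) (simp add: mult_ac)
  then have "\<bar>\<Sum>k = 1..N. a k * s k\<bar> \<le> (\<Sum>j = 1..d. \<bar>w j * (\<Sum>k = 1..N. a k * r j ^ k)\<bar>)"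
    using sum_abs by metis
  also have "\<dots> \<le> (\<Sum>j = 1..d. \<bar>w j\<bar> * \<epsilon>)"
    unfolding abs_mult using r by (intro sum_mono mult_left_mono bound) fastforce+
  also have "\<dots> \<le> 4 * \<epsilon>"
    unfolding sum_distrib_right[symmetric] using w4 eps by (rule mult_right_mono)
  finally have 2: "\<bar>\<Sum>k = 1..N. a k * s k\<bar> \<le> 4 * \<epsilon>" .
  have "\<bar>y\<bar> \<le> 4 * (\<epsilon> + t)" if "\<bar>x - y\<bar> \<le> 4 * t" "\<bar>x\<bar> \<le> 4 * \<epsilon>" for x y t :: real
    using that unfolding abs_le_iff by (auto simp: algebra_simps)
  from this[OF 1 2] have "\<bar>a 1 / D\<bar> \<le> 4 * (\<epsilon> + (1 / 2) ^ d)" .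
  then have "\<bar>a 1\<bar> \<le> D * (4 * (\<epsilon> + (1 / 2) ^ d))"
    using D by (simp add: abs_divide field_simps)
  then show ?thesis by (simp add: D_def algebra_simps)
qed

section \<open>Choice of the truncation degree\<close>

lemma square_le_sqrt2_powers: "(real d)\<^sup>2 \<le> 6 * sqrt 2 ^ d"
proof -
  \<comment> \<open>The squared claim. From \<open>d = 7\<close> on, one step multiplies the left
    side by at most \<open>(8 / 7) ^ 4\<close>, which is below 2; smaller \<open>d\<close> are
    checked by hand.\<close>
  have "(real d) ^ 4 \<le> 36 * 2 ^ d"
  proof (cases "d < 7")
    case True
    then have "d \<in> {0,1,2,3,4,5,6}" by auto
    then show ?thesis by auto
  next
    case False
    then have "7 \<le> d" by simp
    then show ?thesis
    proof (induction d rule: dec_induct)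
      case (step d)
      have "real (Suc d) / real d \<le> 8 / 7"
        using step by (simp add: field_simps)
      then have "(real (Suc d) / real d) ^ 4 \<le> (8 / 7) ^ 4"
        by (intro power_mono) auto
      also have "\<dots> \<le> (2 :: real)" by (simp add: field_simps)
      finally have "real (Suc d) ^ 4 \<le> 2 * real d ^ 4"
        using step by (simp add: power_divide divide_simps del: of_nat_Suc split: if_splits)
      then show ?case using step by simp
    qed simp
  qed
  then have "((real d)\<^sup>2)\<^sup>2 \<le> (6 * sqrt 2 ^ d)\<^sup>2"
    by (simp add: power_mult_distrib flip: power_mult) (simp add: mult.commute[of d] power_mult)
  then show ?thesis by (rule power2_le_imp_le) simp
qed

text \<open>With \<open>d\<close> proportional to log(1/S) the truncation error is at most S/2 and
  can be absorbed on the left. What remains is \<open>S \<le> 16 * d\<^sup>2 * \<epsilon>\<close>,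
  and dividing by the squared logarithm produces \<open>Phi S\<close>.\<close>

lemma Phi_le_of_endpoint_bounds:
  assumes S: "0 \<le> S" "S \<le> 1" and eps: "\<epsilon> \<ge> 0"
    and bound: "\<And>d. d \<ge> 1 \<Longrightarrow> S \<le> 8 * (real d)\<^sup>2 * (\<epsilon> + (1 / 2) ^ d)"
  shows "Phi S \<le> 16 * 31\<^sup>2 * \<epsilon>"
proof (cases "S = 0")
  case True
  then show ?thesis using eps by (simp add: Phi_def)
next
  case False
  then have S0: "S > 0" using S by simp
  \<comment> \<open>The cutoff at 1 handles S near 1, where the logarithm vanishes, and absorbs the
    rounding in \<open>d \<le> 31 * L\<close>.\<close>
  define L where "L = max 1 (ln (1 / S))"
  define d where "d = nat \<lceil>30 * L\<rceil>"
  have L: "L \<ge> 1" by (simp add: L_def)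
  have d: "real d \<ge> 30 * L" "real d \<le> 31 * L"
    using L by (auto simp: d_def) linarith+
  have "exp (- L) \<le> exp (- ln (1 / S))" by (simp add: L_def)
  also have "\<dots> = S" using S0 by (simp add: ln_div)
  finally have LS: "exp (- L) \<le> S" .
  \<comment> \<open>Here 96 is 16 * 6, with 6 from \<open>square_le_sqrt2_powers\<close>. Since ln 2
    is at least 2/3, \<open>d \<ge> 30 * L\<close> gives decay \<open>exp (- (10 * L))\<close>; one
    factor \<open>exp (- L)\<close> is kept and the other nine outweigh ln 96, which is at most
    7.\<close>
  have "96 * (1 / sqrt 2) ^ d \<le> exp (- L)"
  proof -
    have ln2: "ln (2::real) \<ge> 2 / 3" by (rule ln2_ge_two_thirds)
    have "ln (96::real) \<le> ln (2 ^ 7)" by (subst ln_le_cancel_iff) auto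
    also have "\<dots> \<le> 7" using ln_realpow[of 2 7] ln_2_less_1 by simp
    finally have l96: "ln (96::real) \<le> 7" .
    have e: "96 = exp (ln (96::real))" by simp
    have "1 / sqrt 2 = exp (- (ln 2 / 2))"
      by (simp add: exp_minus ln_sqrt[symmetric] inverse_eq_divide)
    then have "(1 / sqrt 2) ^ d = exp (- (real d * (ln 2 / 2)))"
      by (simp add: exp_of_nat_mult[symmetric])
    moreover have "real d * (ln 2 / 2) \<ge> 30 * L * (1 / 3)"
      using d L ln2 by (intro mult_mono) auto
    ultimately have "(1 / sqrt 2) ^ d \<le> exp (- (10 * L))" by simp
    then have "96 * (1 / sqrt 2) ^ d \<le> exp (ln 96) * exp (- (10 * L))"
      by simp
    also have "\<dots> = exp (ln 96 - 10 * L)" by (simp add: exp_diff exp_minus field_simps)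
    also have "\<dots> \<le> exp (- L)" using l96 L by simp
    finally show ?thesis .
  qed
  moreover have "16 * (real d)\<^sup>2 * (1 / 2) ^ d \<le> 96 * (1 / sqrt 2) ^ d"
  proof -
    \<comment> \<open>One half of the exponential decay is spent on \<open>d\<^sup>2\<close>, the
      other half is kept.\<close>
    have "(1 / 2 :: real) ^ d = (1 / sqrt 2) ^ d * (1 / sqrt 2) ^ d"
      by (simp flip: power_mult_distrib)
    moreover have "(real d)\<^sup>2 * (1 / sqrt 2) ^ d \<le> 6"
      using square_le_sqrt2_powers[of d] by (simp add: power_divide field_simps)
    ultimately show ?thesis
      using mult_right_mono[of "(real d)\<^sup>2 * (1 / sqrt 2) ^ d" 6 "(1 / sqrt 2) ^ d"] by simp
  qed
  ultimately have "8 * (real d)\<^sup>2 * (1 / 2) ^ d \<le> S / 2" using LS by simp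
  moreover have "S \<le> 8 * (real d)\<^sup>2 * \<epsilon> + 8 * (real d)\<^sup>2 * (1 / 2) ^ d"
    using bound[of d] d L by (simp add: distrib_left)
  ultimately have "S \<le> 16 * (real d)\<^sup>2 * \<epsilon>" by simp
  also have "\<dots> \<le> 16 * (31 * L)\<^sup>2 * \<epsilon>"
    using d eps by (intro mult_right_mono mult_left_mono power_mono) auto
  finally have "S / L\<^sup>2 \<le> 16 * 31\<^sup>2 * \<epsilon>"
    using L by (simp add: field_simps power_mult_distrib)
  \<comment> \<open>If ln(1/S) is at least 1, it equals \<open>L\<close> and the second argument of
    the minimum applies; otherwise \<open>L = 1\<close> and \<open>Phi S \<le> S\<close>, including
    the value set at S = 1.\<close>
  moreover have "Phi S \<le> S / L\<^sup>2"
  proof (cases "ln (1 / S) \<ge> 1")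
    case True
    then have "S \<noteq> 1" by auto
    with True False show ?thesis by (simp add: Phi_def L_def max_def)
  next
    case ln: False
    then show ?thesis using False by (simp add: Phi_def L_def max_def min_def)
  qed
  ultimately show ?thesis by linarith
qed

subsection \<open>Parseval's identity for the cosine basis on the unit interval\<close>

definition unif :: "real measure" where
  "unif = restrict_space lborel {0..1}"

lemma space_unif [simp]: "space unif = {0..1}"
  by (simp add: unif_def space_restrict_space)

lemma sets_unif [measurable_cong]: "sets unif = sets (restrict_space borel {0..1})"
  unfolding unif_def by (intro sets_restrict_space_cong) simp

interpretation unif: prob_space unif
  by (rule prob_spaceI) (simp add: unif_def space_restrict_space emeasure_restrict_space)

lemma integrable_unif_continuous:
  fixes f :: "real \<Rightarrow> real"
  assumes "continuous_on {0..1} f"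
  shows "integrable unif f"
proof -
  have "bounded (f ` {0..1})"
    using assms by (intro compact_imp_bounded compact_continuous_image) auto
  then obtain B where "\<forall>x\<in>f ` {0..1}. norm x \<le> B"
    unfolding bounded_iff by blast
  then have "norm (f t) \<le> B" if "t \<in> {0..1}" for t
    using that by blast
  moreover have "f \<in> borel_measurable unif"
    using borel_measurable_continuous_on_restrict[OF assms]
    by (simp cong: measurable_cong_sets add: sets_unif)
  ultimately show ?thesis
    by (intro unif.integrable_const_bound[where B = B] AE_I2) auto
qed

definition cos_mode :: "nat \<Rightarrow> real \<Rightarrow> real" where
  "cos_mode k t = (if k = 0 then 1 else sqrt 2 * cos (pi * real k * t))"

lemma continuous_on_cos_mode [continuous_intros]: "continuous_on A (cos_mode k)"
  by (cases "k = 0") (auto simp: cos_mode_def [abs_def] intro!: continuous_intros)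

text \<open>The frequency is an integer because product-to-sum formulas produce differences of
  either sign.\<close>

lemma integral_cos_unif:
  assumes "m \<noteq> 0"
  shows "(\<integral>t. cos (pi * of_int m * t) \<partial>unif) = 0"
proof -
  have "(\<integral>t. cos (pi * of_int m * t) \<partial>unif)
      = (\<integral>t. cos (pi * of_int m * t) * indicator {0..1} t \<partial>lborel)"
    unfolding unif_def by (subst integral_restrict_space) (auto simp: mult.commute)
  also have "\<dots> = sin (pi * of_int m * 1) / (pi * of_int m) - sin (pi * of_int m * 0) / (pi * of_int m)"
    using assms by (intro integral_FTC_Icc_real) (auto intro!: derivative_eq_intros)
  finally show ?thesis by (simp add: sin_integer_2pi sin_times_pi_eq_0 mult.commute[of pi])
qed

lemma cos_mode_orthonormal:
  "(\<integral>t. cos_mode j t * cos_mode k t \<partial>unif) = (if j = k then 1 else 0)"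
proof -
  have int: "(\<integral>t. cos (pi * of_int m * t) \<partial>unif) = (if m = 0 then 1 else 0)" for m
    using integral_cos_unif[of m] unif.prob_space by auto
  have nat: "(\<integral>t. cos (pi * real l * t) \<partial>unif) = 0" if "l \<noteq> 0" for l :: nat
    using int[of "int l"] that by simp
  show ?thesis
  proof (cases "j = 0 \<or> k = 0")
    case True
    then show ?thesis using nat unif.prob_space by (auto simp: cos_mode_def)
  next
    case False
    then have "(\<integral>t. cos_mode j t * cos_mode k t \<partial>unif)
        = (\<integral>t. cos (pi * of_int (int j - int k) * t) + cos (pi * of_int (int j + int k) * t) \<partial>unif)"
      by (intro Bochner_Integration.integral_cong)
         (auto simp: cos_mode_def algebra_simps cos_add cos_diff)
    also have "\<dots> = (\<integral>t. cos (pi * of_int (int j - int k) * t) \<partial>unif)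
        + (\<integral>t. cos (pi * of_int (int j + int k) * t) \<partial>unif)"
      by (intro Bochner_Integration.integral_add integrable_unif_continuous continuous_intros)
    also have "\<dots> = (if j = k then 1 else 0)"
      using False unfolding int by auto
    finally show ?thesis .
  qed
qed

section \<open>Density of cosine polynomials\<close>

inductive cos_poly :: "(real \<Rightarrow> real) \<Rightarrow> bool" where
  mode: "cos_poly (\<lambda>t. a * cos (pi * real k * t))"
| add: "cos_poly p \<Longrightarrow> cos_poly q \<Longrightarrow> cos_poly (\<lambda>t. p t + q t)"

text \<open>The product-to-sum formula keeps products within sums of cosines, so they form an
  algebra, as Stone-Weierstrass demands.\<close>

lemma cos_poly_mult:
  assumes "cos_poly p" "cos_poly q"
  shows "cos_poly (\<lambda>t. p t * q t)"
  using assms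
proof (induction p)
  case (mode a k)
  from mode show ?case
  proof (induction q)
    case (mode b l)
    \<comment> \<open>The distance of \<open>k\<close> and \<open>l\<close> as a natural number;
      evenness of the cosine makes the sign immaterial.\<close>
    define m where "m = (if k \<le> l then l - k else k - l)"
    have "cos (pi * real m * t) = cos (pi * real k * t - pi * real l * t)" for t
    proof (cases "k \<le> l")
      case True
      then have "pi * real m * t = - (pi * real k * t - pi * real l * t)"
        by (simp add: m_def of_nat_diff algebra_simps)
      then show ?thesis by (metis cos_minus)
    next
      case False
      then have "pi * real m * t = pi * real k * t - pi * real l * t"
        by (simp add: m_def of_nat_diff algebra_simps)
      then show ?thesis by simp
    qed
    then have "(\<lambda>t. (a * cos (pi * real k * t)) * (b * cos (pi * real l * t)))
        = (\<lambda>t. (a * b / 2) * cos (pi * real (k + l) * t) + (a * b / 2) * cos (pi * real m * t))"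
      by (simp add: fun_eq_iff cos_diff distrib_left distrib_right cos_add)
         (simp add: field_simps)
    then show ?case by (simp only:) (intro cos_poly.intros)
  next
    case (add p q)
    then show ?case using cos_poly.add[OF add.IH] by (simp add: distrib_left)
  qed
next
  case (add p p')
  then show ?case
    using cos_poly.add[of "\<lambda>t. p t * q t" "\<lambda>t. p' t * q t"] by (simp add: distrib_right)
qed

lemma continuous_on_cos_poly: "cos_poly p \<Longrightarrow> continuous_on A p"
  by (induction p rule: cos_poly.induct) (auto intro!: continuous_intros)

text \<open>Stone-Weierstrass: frequency 0 supplies the constants, and cos(pi t) already separates
  points because it is injective on [0,1].\<close>

lemma cos_poly_dense:
  fixes \<psi> :: "real \<Rightarrow> real"
  assumes "continuous_on {0..1} \<psi>" "e > 0"
  obtains p where "cos_poly p" "\<And>t. t \<in> {0..1} \<Longrightarrow> \<bar>\<psi> t - p t\<bar> < e"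
proof -
  have "\<exists>p. cos_poly p \<and> (\<forall>t\<in>{0..1}. \<bar>\<psi> t - p t\<bar> < e)"
  proof (rule Stone_Weierstrass_HOL)
    show "cos_poly (\<lambda>t. c)" for c
      using cos_poly.mode[of c 0] by simp
    fix s t :: real assume st: "s \<in> {0..1} \<and> t \<in> {0..1} \<and> s \<noteq> t"
    then have "cos (pi * s) \<noteq> cos (pi * t)"
      using cos_inj_pi[of "pi * s" "pi * t"] by (auto simp: mult_le_cancel_left1)
    moreover have "cos_poly (\<lambda>t. cos (pi * t))"
      using cos_poly.mode[of 1 1] by simp
    ultimately show "\<exists>p. cos_poly p \<and> p s \<noteq> p t" by blast
  qed (use assms in \<open>auto intro: cos_poly_mult cos_poly.add continuous_on_cos_poly\<close>)
  then show ?thesis using that by blast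
qed

section \<open>Partial cosine sums and their residuals\<close>

definition unit_coeff :: "(real \<Rightarrow> real) \<Rightarrow> nat \<Rightarrow> real" where
  "unit_coeff \<psi> k = (\<integral>t. \<psi> t * cos_mode k t \<partial>unif)"

definition cos_residual :: "(real \<Rightarrow> real) \<Rightarrow> nat set \<Rightarrow> real \<Rightarrow> real" where
  "cos_residual \<psi> F t = \<psi> t - (\<Sum>k\<in>F. unit_coeff \<psi> k * cos_mode k t)"

context
  fixes \<psi> :: "real \<Rightarrow> real"
  assumes cont: "continuous_on {0..1} \<psi>"
begin

lemma continuous_on_cos_residual: "continuous_on {0..1} (cos_residual \<psi> F)"
  unfolding cos_residual_def using cont by (intro continuous_intros)

lemma integral_cos_residual_mult:
  assumes "continuous_on {0..1} h"
  shows "(\<integral>t. cos_residual \<psi> F t * h t \<partial>unif)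
    = (\<integral>t. \<psi> t * h t \<partial>unif) - (\<Sum>k\<in>F. unit_coeff \<psi> k * (\<integral>t. cos_mode k t * h t \<partial>unif))"
proof -
  have "(\<integral>t. cos_residual \<psi> F t * h t \<partial>unif)
      = (\<integral>t. \<psi> t * h t - (\<Sum>k\<in>F. unit_coeff \<psi> k * (cos_mode k t * h t)) \<partial>unif)"
    by (simp add: cos_residual_def left_diff_distrib sum_distrib_right mult.assoc)
  also have "\<dots> = (\<integral>t. \<psi> t * h t \<partial>unif) - (\<integral>t. (\<Sum>k\<in>F. unit_coeff \<psi> k * (cos_mode k t * h t)) \<partial>unif)"
    using cont assms
    by (intro Bochner_Integration.integral_diff integrable_unif_continuous continuous_intros)
  also have "(\<integral>t. (\<Sum>k\<in>F. unit_coeff \<psi> k * (cos_mode k t * h t)) \<partial>unif)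
      = (\<Sum>k\<in>F. (\<integral>t. unit_coeff \<psi> k * (cos_mode k t * h t) \<partial>unif))"
    using assms
    by (intro Bochner_Integration.integral_sum integrable_unif_continuous continuous_intros)
  finally show ?thesis by simp
qed

lemma cos_residual_orthogonal:
  assumes "finite F" "k \<in> F"
  shows "(\<integral>t. cos_residual \<psi> F t * cos_mode k t \<partial>unif) = 0"
  using assms
  by (subst integral_cos_residual_mult)
     (auto simp: cos_mode_orthonormal continuous_on_cos_mode unit_coeff_def if_distrib[of "\<lambda>x. _ * x"] cong: if_cong)

text \<open>The residual is orthogonal to the partial sum that was subtracted.\<close>

lemma integral_cos_residual_self:
  assumes "finite F"
  shows "(\<integral>t. (cos_residual \<psi> F t)\<^sup>2 \<partial>unif) = (\<integral>t. cos_residual \<psi> F t * \<psi> t \<partial>unif)"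
proof -
  have "(\<integral>t. cos_residual \<psi> F t * (\<Sum>k\<in>F. unit_coeff \<psi> k * cos_mode k t) \<partial>unif)
      = (\<Sum>k\<in>F. unit_coeff \<psi> k * (\<integral>t. cos_residual \<psi> F t * cos_mode k t \<partial>unif))"
    unfolding sum_distrib_left
    using continuous_on_cos_residual
    by (subst Bochner_Integration.integral_sum) (auto intro!: integrable_unif_continuous continuous_intros simp: mult.left_commute)
  also have "\<dots> = 0"
    using assms by (simp add: cos_residual_orthogonal)
  finally have "(\<integral>t. cos_residual \<psi> F t * (\<Sum>k\<in>F. unit_coeff \<psi> k * cos_mode k t) \<partial>unif) = 0" .
  moreover have "(\<integral>t. (cos_residual \<psi> F t)\<^sup>2 \<partial>unif)
      = (\<integral>t. cos_residual \<psi> F t * \<psi> t - cos_residual \<psi> F t * (\<Sum>k\<in>F. unit_coeff \<psi> k * cos_mode k t) \<partial>unif)"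
    by (simp add: power2_eq_square flip: right_diff_distrib) (simp add: cos_residual_def)
  moreover have "\<dots> = (\<integral>t. cos_residual \<psi> F t * \<psi> t \<partial>unif)
      - (\<integral>t. cos_residual \<psi> F t * (\<Sum>k\<in>F. unit_coeff \<psi> k * cos_mode k t) \<partial>unif)"
    using cont continuous_on_cos_residual
    by (intro Bochner_Integration.integral_diff integrable_unif_continuous continuous_intros)
  ultimately show ?thesis by simp
qed

lemma integral_cos_residual_sq:
  assumes "finite F"
  shows "(\<integral>t. (cos_residual \<psi> F t)\<^sup>2 \<partial>unif) = (\<integral>t. (\<psi> t)\<^sup>2 \<partial>unif) - (\<Sum>k\<in>F. (unit_coeff \<psi> k)\<^sup>2)"
  using integral_cos_residual_mult[OF cont, of F]
  unfolding integral_cos_residual_self[OF assms]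
  by (simp add: unit_coeff_def power2_eq_square mult.commute)

text \<open>\<open>K\<close> collects the finitely many modes that occur in \<open>p\<close>; each
  is orthogonal to the residual as soon as \<open>F\<close> contains it.\<close>

lemma cos_residual_orthogonal_cos_poly:
  assumes "cos_poly p"
  obtains K where "finite K"
    "\<And>F. finite F \<Longrightarrow> K \<subseteq> F \<Longrightarrow> (\<integral>t. cos_residual \<psi> F t * p t \<partial>unif) = 0"
proof -
  have "\<exists>K. finite K \<and> (\<forall>F. finite F \<longrightarrow> K \<subseteq> F \<longrightarrow> (\<integral>t. cos_residual \<psi> F t * p t \<partial>unif) = 0)"
    using assms
  proof (induction p)
    case (mode a k)
    have "a * cos (pi * real k * t) = (if k = 0 then a else a / sqrt 2) * cos_mode k t" for t
      by (simp add: cos_mode_def)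
    then have "(\<integral>t. cos_residual \<psi> F t * (a * cos (pi * real k * t)) \<partial>unif)
        = (if k = 0 then a else a / sqrt 2) * (\<integral>t. cos_residual \<psi> F t * cos_mode k t \<partial>unif)" for F
      by (simp add: mult.left_commute)
    then show ?case by (intro exI[of _ "{k}"]) (simp add: cos_residual_orthogonal)
  next
    case (add p q)
    then obtain K L where K: "finite K" "\<And>F. finite F \<Longrightarrow> K \<subseteq> F \<Longrightarrow> (\<integral>t. cos_residual \<psi> F t * p t \<partial>unif) = 0"
      and L: "finite L" "\<And>F. finite F \<Longrightarrow> L \<subseteq> F \<Longrightarrow> (\<integral>t. cos_residual \<psi> F t * q t \<partial>unif) = 0"
      by blast
    have "(\<integral>t. cos_residual \<psi> F t * (p t + q t) \<partial>unif)
        = (\<integral>t. cos_residual \<psi> F t * p t \<partial>unif) + (\<integral>t. cos_residual \<psi> F t * q t \<partial>unif)" for F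
      unfolding distrib_left
      using continuous_on_cos_residual add.hyps[THEN continuous_on_cos_poly]
      by (intro Bochner_Integration.integral_add integrable_unif_continuous continuous_intros)
    then show ?case using K L by (intro exI[of _ "K \<union> L"]) simp
  qed
  then show ?thesis using that by blast
qed

text \<open>The squared norm of the residual r is its inner product with \<open>\<psi>\<close>,
  hence with \<open>\<psi> - p\<close> for a nearby cosine polynomial \<open>p\<close> orthogonal to
  r. Then 2ab \<le> a^2 + b^2 bounds it by half of itself plus e/4, hence by e/2.\<close>

lemma parseval_square: "((\<lambda>k. (unit_coeff \<psi> k)\<^sup>2) has_sum (\<integral>t. (\<psi> t)\<^sup>2 \<partial>unif)) UNIV"
  unfolding has_sum_def tendsto_iff eventually_finite_subsets_at_top
proof (intro allI impI)
  fix e :: real assume e: "e > 0"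
  define \<delta> where "\<delta> = sqrt (e / 2)"
  have \<delta>: "\<delta> > 0" "\<delta>\<^sup>2 = e / 2" using e by (auto simp: \<delta>_def)
  obtain p where p: "cos_poly p" "\<And>t. t \<in> {0..1} \<Longrightarrow> \<bar>\<psi> t - p t\<bar> < \<delta>"
    using cos_poly_dense[OF cont \<delta>(1)] by blast
  obtain K where K: "finite K" "\<And>F. finite F \<Longrightarrow> K \<subseteq> F \<Longrightarrow> (\<integral>t. cos_residual \<psi> F t * p t \<partial>unif) = 0"
    using cos_residual_orthogonal_cos_poly[OF p(1)] by blast
  show "\<exists>X. finite X \<and> X \<subseteq> UNIV \<and>
      (\<forall>Y. finite Y \<and> X \<subseteq> Y \<and> Y \<subseteq> UNIV \<longrightarrow>
        dist (\<Sum>k\<in>Y. (unit_coeff \<psi> k)\<^sup>2) (\<integral>t. (\<psi> t)\<^sup>2 \<partial>unif) < e)"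
  proof (intro exI[of _ K] conjI allI impI)
    fix F assume "finite F \<and> K \<subseteq> F \<and> F \<subseteq> UNIV"
    then have F: "finite F" "K \<subseteq> F" by auto
    define r where "r = cos_residual \<psi> F"
    have r: "continuous_on {0..1} r" unfolding r_def by (rule continuous_on_cos_residual)
    have pc: "continuous_on {0..1} p" by (rule continuous_on_cos_poly) fact
    have rp: "(\<integral>t. r t * p t \<partial>unif) = 0" unfolding r_def using K F by blast
    have "(\<integral>t. (r t)\<^sup>2 \<partial>unif) = (\<integral>t. r t * \<psi> t \<partial>unif) - (\<integral>t. r t * p t \<partial>unif)"
      unfolding rp using integral_cos_residual_self[OF F(1)] by (simp add: r_def)
    also have "\<dots> = (\<integral>t. r t * \<psi> t - r t * p t \<partial>unif)"
      using r pc cont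
      by (intro Bochner_Integration.integral_diff[symmetric] integrable_unif_continuous continuous_intros)
    also have "\<dots> \<le> (\<integral>t. (r t)\<^sup>2 / 2 + e / 4 \<partial>unif)"
    proof (rule integral_mono)
      fix t assume "t \<in> space unif"
      then have "\<bar>\<psi> t - p t\<bar> \<le> \<delta>" using p(2)[of t] by simp
      then have "(\<psi> t - p t)\<^sup>2 \<le> e / 2"
        using \<delta> abs_le_square_iff[of "\<psi> t - p t" \<delta>] by simp
      moreover have "2 * (r t * (\<psi> t - p t)) \<le> (r t)\<^sup>2 + (\<psi> t - p t)\<^sup>2"
        using sum_squares_bound[of "r t" "\<psi> t - p t"] by (simp add: mult.assoc)
      ultimately show "r t * \<psi> t - r t * p t \<le> (r t)\<^sup>2 / 2 + e / 4"
        by (simp add: right_diff_distrib)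
    qed (use r pc cont in \<open>intro integrable_unif_continuous continuous_intros; simp\<close>)+
    also have "\<dots> = (\<integral>t. (r t)\<^sup>2 / 2 \<partial>unif) + (\<integral>t. e / 4 \<partial>unif)"
      using r by (intro Bochner_Integration.integral_add integrable_unif_continuous continuous_intros) auto
    also have "\<dots> = (\<integral>t. (r t)\<^sup>2 \<partial>unif) / 2 + e / 4"
      using unif.prob_space by simp
    finally have "(\<integral>t. (r t)\<^sup>2 \<partial>unif) \<le> e / 2" by simp
    moreover have "0 \<le> (\<integral>t. (r t)\<^sup>2 \<partial>unif)" by simp
    ultimately show "dist (\<Sum>k\<in>F. (unit_coeff \<psi> k)\<^sup>2) (\<integral>t. (\<psi> t)\<^sup>2 \<partial>unif) < e"
      using integral_cos_residual_sq[OF F(1)] e by (simp add: r_def dist_real_def)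
  qed (use K in auto)
qed

end

text \<open>Polarisation of \<open>parseval_square\<close>: coefficients and integrals alike are
  recovered as a quarter of the difference of the squares of sum and difference.\<close>

lemma parseval:
  assumes "continuous_on {0..1} \<psi>" "continuous_on {0..1} \<eta>"
  shows "((\<lambda>k. unit_coeff \<psi> k * unit_coeff \<eta> k) has_sum (\<integral>t. \<psi> t * \<eta> t \<partial>unif)) UNIV"
proof -
  have int: "integrable unif (\<lambda>t. \<psi> t * cos_mode k t)" "integrable unif (\<lambda>t. \<eta> t * cos_mode k t)"
    "integrable unif (\<lambda>t. (\<psi> t + \<eta> t)\<^sup>2)" "integrable unif (\<lambda>t. (\<psi> t - \<eta> t)\<^sup>2)" for k
    using assms by (auto intro!: integrable_unif_continuous continuous_intros)
  have "((\<lambda>k. (unit_coeff (\<lambda>t. \<psi> t + \<eta> t) k)\<^sup>2) has_sum (\<integral>t. (\<psi> t + \<eta> t)\<^sup>2 \<partial>unif)) UNIV"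
    "((\<lambda>k. (unit_coeff (\<lambda>t. \<psi> t - \<eta> t) k)\<^sup>2) has_sum (\<integral>t. (\<psi> t - \<eta> t)\<^sup>2 \<partial>unif)) UNIV"
    using assms by (auto intro!: parseval_square continuous_intros)
  note this[THEN has_sum_cmult_right]
  from has_sum_add[OF this(1)[of "1 / 4"] this(2)[of "- 1 / 4"]]
  have "((\<lambda>k. 1 / 4 * (unit_coeff (\<lambda>t. \<psi> t + \<eta> t) k)\<^sup>2 + - 1 / 4 * (unit_coeff (\<lambda>t. \<psi> t - \<eta> t) k)\<^sup>2)
    has_sum (1 / 4 * (\<integral>t. (\<psi> t + \<eta> t)\<^sup>2 \<partial>unif) + - 1 / 4 * (\<integral>t. (\<psi> t - \<eta> t)\<^sup>2 \<partial>unif))) UNIV" .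
  also have "(\<lambda>k. 1 / 4 * (unit_coeff (\<lambda>t. \<psi> t + \<eta> t) k)\<^sup>2 + - 1 / 4 * (unit_coeff (\<lambda>t. \<psi> t - \<eta> t) k)\<^sup>2)
      = (\<lambda>k. unit_coeff \<psi> k * unit_coeff \<eta> k)"
    using int(1,2) by (simp add: unit_coeff_def left_diff_distrib distrib_right power2_eq_square fun_eq_iff)
       (simp add: field_simps)
  also have "1 / 4 * (\<integral>t. (\<psi> t + \<eta> t)\<^sup>2 \<partial>unif) + - 1 / 4 * (\<integral>t. (\<psi> t - \<eta> t)\<^sup>2 \<partial>unif)
      = (\<integral>t. 1 / 4 * (\<psi> t + \<eta> t)\<^sup>2 + - 1 / 4 * (\<psi> t - \<eta> t)\<^sup>2 \<partial>unif)"
    using int(3,4) by (subst Bochner_Integration.integral_add) auto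
  also have "\<dots> = (\<integral>t. \<psi> t * \<eta> t \<partial>unif)"
    by (intro Bochner_Integration.integral_cong) (auto simp: power2_eq_square algebra_simps)
  finally show ?thesis .
qed

text \<open>The coefficients of mode 0 are the means, so dropping that mode leaves the
  covariance.\<close>

lemma parseval_nonconstant:
  assumes "continuous_on {0..1} \<psi>" "continuous_on {0..1} \<eta>"
  shows "((\<lambda>k. unit_coeff \<psi> k * unit_coeff \<eta> k) has_sum
    ((\<integral>t. \<psi> t * \<eta> t \<partial>unif) - (\<integral>t. \<psi> t \<partial>unif) * (\<integral>t. \<eta> t \<partial>unif))) (UNIV - {0})"
proof -
  have "((\<lambda>k. unit_coeff \<psi> k * unit_coeff \<eta> k) has_sum
      ((\<integral>t. \<psi> t * \<eta> t \<partial>unif) - (\<Sum>k\<in>{0}. unit_coeff \<psi> k * unit_coeff \<eta> k))) (UNIV - {0})"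
    by (intro has_sum_Diff parseval assms has_sum_finite) auto
  then show ?thesis by (simp add: unit_coeff_def cos_mode_def)
qed

subsection \<open>Averaging over coordinates of the cube\<close>

lemma unif_cube_eq: "unif_cube n = Pi\<^sub>M {..<n} (\<lambda>_. unif)"
  by (simp add: unif_cube_def unif_def)

interpretation unif_product: product_sigma_finite "\<lambda>_::nat. unif"
  by standard

interpretation unif_cube: prob_space "unif_cube n" for n
  by (rule prob_space_unif_cube)

interpretation unif_cube_unif: pair_prob_space "unif_cube n" unif for n
  by standard

lemma fun_upd_cube: "x \<in> cube n \<Longrightarrow> j < n \<Longrightarrow> t \<in> {0..1} \<Longrightarrow> x(j := t) \<in> cube n"
  by (auto simp: cube_def PiE_iff extensional_def)

text \<open>A class closed under sums, products and coordinate averages on which every integral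
  below exists; it spares separate integrability arguments.\<close>

definition bounded_rv :: "nat \<Rightarrow> ((nat \<Rightarrow> real) \<Rightarrow> real) \<Rightarrow> bool" where
  "bounded_rv n f \<longleftrightarrow> f \<in> borel_measurable (unif_cube n) \<and> (\<exists>B. \<forall>x\<in>cube n. \<bar>f x\<bar> \<le> B)"

lemma bounded_rv_measurable: "bounded_rv n f \<Longrightarrow> f \<in> borel_measurable (unif_cube n)"
  by (simp add: bounded_rv_def)

lemma bounded_rv_bound:
  assumes "bounded_rv n f"
  obtains B where "B \<ge> 0" "\<And>x. x \<in> cube n \<Longrightarrow> \<bar>f x\<bar> \<le> B"
proof -
  obtain B where "\<forall>x\<in>cube n. \<bar>f x\<bar> \<le> B"
    using assms by (auto simp: bounded_rv_def)
  then show ?thesis by (intro that[of "max B 0"]) (auto simp: max_def)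
qed

lemma bounded_rvI:
  "f \<in> borel_measurable (unif_cube n) \<Longrightarrow> (\<And>x. x \<in> cube n \<Longrightarrow> \<bar>f x\<bar> \<le> B) \<Longrightarrow> bounded_rv n f"
  by (auto simp: bounded_rv_def)

lemma bounded_rv_cong:
  assumes "\<And>x. x \<in> cube n \<Longrightarrow> f x = g x"
  shows "bounded_rv n f \<longleftrightarrow> bounded_rv n g"
  using assms measurable_cong[of "unif_cube n" f g borel]
  by (auto simp: bounded_rv_def space_unif_cube)

lemma bounded_rv_const [intro!]: "bounded_rv n (\<lambda>x. c)"
  by (auto simp: bounded_rv_def)

lemma bounded_rv_add [intro!]:
  assumes "bounded_rv n f" "bounded_rv n g"
  shows "bounded_rv n (\<lambda>x. f x + g x)"
proof -
  obtain B C where "\<And>x. x \<in> cube n \<Longrightarrow> \<bar>f x\<bar> \<le> B" "\<And>x. x \<in> cube n \<Longrightarrow> \<bar>g x\<bar> \<le> C"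
    using assms bounded_rv_bound by metis
  then show ?thesis
    using assms[THEN bounded_rv_measurable]
    by (intro bounded_rvI[where B = "B + C"]) (auto intro: order_trans[OF abs_triangle_ineq] add_mono)
qed

lemma bounded_rv_mult [intro!]:
  assumes "bounded_rv n f" "bounded_rv n g"
  shows "bounded_rv n (\<lambda>x. f x * g x)"
proof -
  obtain B C where "B \<ge> 0" "\<And>x. x \<in> cube n \<Longrightarrow> \<bar>f x\<bar> \<le> B" "\<And>x. x \<in> cube n \<Longrightarrow> \<bar>g x\<bar> \<le> C"
    using assms bounded_rv_bound by metis
  then show ?thesis
    using assms[THEN bounded_rv_measurable]
    by (intro bounded_rvI[where B = "B * C"]) (auto simp: abs_mult intro: mult_mono)
qed

lemma bounded_rv_diff [intro!]:
  assumes "bounded_rv n f" "bounded_rv n g"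
  shows "bounded_rv n (\<lambda>x. f x - g x)"
  using bounded_rv_add[OF assms(1) bounded_rv_mult[OF bounded_rv_const[of n "-1"] assms(2)]] by simp

lemma bounded_rv_if [intro!]:
  "(P \<Longrightarrow> bounded_rv n f) \<Longrightarrow> (\<not> P \<Longrightarrow> bounded_rv n g) \<Longrightarrow> bounded_rv n (\<lambda>x. if P then f x else g x)"
  by (cases P) auto

lemma bounded_rv_divide [intro!]: "bounded_rv n f \<Longrightarrow> bounded_rv n (\<lambda>x. f x / c)"
  using bounded_rv_mult[of n f "\<lambda>x. 1 / c"] by auto

lemma bounded_rv_sum [intro!]: "(\<And>i. i \<in> I \<Longrightarrow> bounded_rv n (f i)) \<Longrightarrow> bounded_rv n (\<lambda>x. \<Sum>i\<in>I. f i x)"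
  by (induction I rule: infinite_finite_induct) auto

lemma bounded_rv_integrable [simp]:
  assumes "bounded_rv n f"
  shows "integrable (unif_cube n) f"
proof -
  obtain B where "\<And>x. x \<in> cube n \<Longrightarrow> \<bar>f x\<bar> \<le> B"
    using assms bounded_rv_bound by metis
  then show ?thesis
    using assms
    by (intro unif_cube.integrable_const_bound[where B = B] AE_I2)
       (auto simp: space_unif_cube bounded_rv_measurable)
qed

lemma expect_cong: "(\<And>x. x \<in> cube n \<Longrightarrow> f x = g x) \<Longrightarrow> expect n f = expect n g"
  unfolding expect_def by (intro Bochner_Integration.integral_cong) (auto simp: space_unif_cube)

lemma expect_const [simp]: "expect n (\<lambda>x. c) = c"
  using unif_cube.prob_space by (simp add: expect_def)

lemma expect_mono:
  "bounded_rv n f \<Longrightarrow> bounded_rv n g \<Longrightarrow> (\<And>x. x \<in> cube n \<Longrightarrow> f x \<le> g x) \<Longrightarrow> expect n f \<le> expect n g"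
  unfolding expect_def by (intro integral_mono) (auto simp: space_unif_cube)

lemma expect_add: "bounded_rv n f \<Longrightarrow> bounded_rv n g \<Longrightarrow> expect n (\<lambda>x. f x + g x) = expect n f + expect n g"
  unfolding expect_def by (intro Bochner_Integration.integral_add) auto

lemma expect_diff: "bounded_rv n f \<Longrightarrow> bounded_rv n g \<Longrightarrow> expect n (\<lambda>x. f x - g x) = expect n f - expect n g"
  unfolding expect_def by (intro Bochner_Integration.integral_diff) auto

lemma expect_sum:
  "(\<And>i. i \<in> I \<Longrightarrow> bounded_rv n (f i)) \<Longrightarrow> expect n (\<lambda>x. \<Sum>i\<in>I. f i x) = (\<Sum>i\<in>I. expect n (f i))"
  unfolding expect_def by (intro Bochner_Integration.integral_sum) auto

lemma expect_mult_left [simp]: "expect n (\<lambda>x. c * f x) = c * expect n f"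
  by (simp add: expect_def)

lemma expect_mult_right [simp]: "expect n (\<lambda>x. f x * c) = expect n f * c"
  by (simp add: expect_def)

lemma measurable_fun_upd_cube:
  assumes "j < n"
  shows "(\<lambda>(x, t). x(j := t)) \<in> measurable (unif_cube n \<Otimes>\<^sub>M unif) (unif_cube n)"
  using measurable_add_dim[of j "{..<n}" "\<lambda>_. unif"] assms
  by (simp add: unif_cube_eq insert_absorb)

lemma measurable_fun_upd_slice:
  assumes "bounded_rv n f" "j < n"
  shows "(\<lambda>(x, t). f (x(j := t))) \<in> borel_measurable (unif_cube n \<Otimes>\<^sub>M unif)"
  using measurable_comp[OF measurable_fun_upd_cube[OF assms(2)] bounded_rv_measurable[OF assms(1)]]
  by (simp add: comp_def case_prod_beta')

lemma integrable_slice [simp]: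
  assumes "bounded_rv n f" "j < n" "x \<in> cube n"
  shows "integrable unif (\<lambda>t. f (x(j := t)))"
proof -
  obtain B where "\<And>x. x \<in> cube n \<Longrightarrow> \<bar>f x\<bar> \<le> B"
    using assms bounded_rv_bound by metis
  moreover have "(\<lambda>t. f (x(j := t))) \<in> borel_measurable unif"
    using measurable_Pair2[OF measurable_fun_upd_slice[OF assms(1,2)], of x] assms
    by (simp add: space_unif_cube)
  ultimately show ?thesis
    using assms fun_upd_cube
    by (intro unif.integrable_const_bound[where B = B] AE_I2) auto
qed

section \<open>Averaging over one coordinate\<close>

definition avg_coord :: "nat \<Rightarrow> ((nat \<Rightarrow> real) \<Rightarrow> real) \<Rightarrow> (nat \<Rightarrow> real) \<Rightarrow> real" where
  "avg_coord j f x = (\<integral>t. f (x(j := t)) \<partial>unif)"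

lemma avg_coord_fun_upd [simp]: "avg_coord j f (x(j := t)) = avg_coord j f x"
  by (simp add: avg_coord_def)

lemma bounded_rv_avg_coord [intro!]:
  assumes "bounded_rv n f" "j < n"
  shows "bounded_rv n (avg_coord j f)"
proof -
  obtain B where B: "\<And>x. x \<in> cube n \<Longrightarrow> \<bar>f x\<bar> \<le> B"
    using assms bounded_rv_bound by metis
  have "\<bar>avg_coord j f x\<bar> \<le> B" if x: "x \<in> cube n" for x
  proof -
    have *: "integrable unif (\<lambda>t. f (x(j := t)))" using assms x by simp
    have "AE t in unif. f (x(j := t)) \<le> B" "AE t in unif. - B \<le> f (x(j := t))"
      using B[OF fun_upd_cube[OF x assms(2)]] by (auto intro!: AE_I2 simp: abs_le_iff minus_le_iff)
    then show ?thesis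
      using unif.integral_le_const[OF *] unif.integral_ge_const[OF *]
      by (simp add: avg_coord_def abs_le_iff minus_le_iff)
  qed
  moreover have "avg_coord j f \<in> borel_measurable (unif_cube n)"
    unfolding avg_coord_def
    using measurable_fun_upd_slice[OF assms] by (intro unif.borel_measurable_lebesgue_integral) auto
  ultimately show ?thesis by (rule bounded_rvI[rotated])
qed

lemma avg_coord_cong:
  "(\<And>x. x \<in> cube n \<Longrightarrow> f x = g x) \<Longrightarrow> j < n \<Longrightarrow> x \<in> cube n \<Longrightarrow> avg_coord j f x = avg_coord j g x"
  unfolding avg_coord_def by (intro Bochner_Integration.integral_cong) (auto simp: fun_upd_cube)

lemma expect_avg_coord:
  assumes "bounded_rv n f" "j < n"
  shows "expect n (avg_coord j f) = expect n f"
proof -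
  \<comment> \<open>Fubini with coordinate \<open>j\<close> innermost. Applied to
    \<open>avg_coord j f\<close>, whose inner average changes nothing, it yields the same outer
    integral as for \<open>f\<close>.\<close>
  have *: "expect n h = (\<integral>x. avg_coord j h x \<partial>Pi\<^sub>M ({..<n} - {j}) (\<lambda>_. unif))"
    if "bounded_rv n h" for h
    using unif_product.product_integral_insert[of "{..<n} - {j}" j h] bounded_rv_integrable[OF that] assms(2)
    by (simp add: expect_def unif_cube_eq avg_coord_def insert_absorb)
  show ?thesis
    using *[OF assms(1)] *[OF bounded_rv_avg_coord[OF assms]] unif.prob_space
    by (simp add: avg_coord_def[of j "avg_coord j f"])
qed

text \<open>Fubini with coordinate \<open>j\<close> outermost. The inner expectation runs over the
  whole cube, but the \<open>j\<close>-th coordinate of its point is overwritten by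
  \<open>t\<close>.\<close>

lemma expect_disintegrate:
  assumes "bounded_rv n f" "j < n"
  shows "expect n f = (\<integral>t. expect n (\<lambda>x. f (x(j := t))) \<partial>unif)"
proof -
  obtain B where B: "\<And>x. x \<in> cube n \<Longrightarrow> \<bar>f x\<bar> \<le> B"
    using assms bounded_rv_bound by metis
  have "integrable (unif_cube n \<Otimes>\<^sub>M unif) (\<lambda>(x, t). f (x(j := t)))"
    using measurable_fun_upd_slice[OF assms] B fun_upd_cube assms(2)
    by (intro unif_cube_unif.P.integrable_const_bound[where B = B] AE_I2)
       (auto simp: space_pair_measure space_unif_cube)
  from unif_cube_unif.Fubini_integral[OF this]
  have "(\<integral>t. expect n (\<lambda>x. f (x(j := t))) \<partial>unif) = expect n (avg_coord j f)"
    by (simp add: expect_def avg_coord_def)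
  then show ?thesis using expect_avg_coord[OF assms] by simp
qed

text \<open>Averaging is an orthogonal projection: \<open>avg_coord j f\<close> is constant in
  coordinate \<open>j\<close> and so comes out of the average of the product. The symmetric right
  side also gives self-adjointness.\<close>

lemma L2_inner_avg_coord_left:
  assumes "bounded_rv n f" "bounded_rv n g" "j < n"
  shows "L2_inner n (avg_coord j f) g = L2_inner n (avg_coord j f) (avg_coord j g)"
proof -
  have "L2_inner n (avg_coord j f) g = expect n (avg_coord j (\<lambda>x. avg_coord j f x * g x))"
    unfolding L2_inner_def using assms by (intro expect_avg_coord[symmetric]) auto
  also have "avg_coord j (\<lambda>x. avg_coord j f x * g x) = (\<lambda>x. avg_coord j f x * avg_coord j g x)"
    by (simp add: avg_coord_def[of j "\<lambda>x. avg_coord j f x * g x"] fun_eq_iff) (simp add: avg_coord_def)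
  finally show ?thesis by (simp add: L2_inner_def)
qed

lemma L2_inner_commute: "L2_inner n f g = L2_inner n g f"
  by (simp add: L2_inner_def mult.commute)

lemma L2_inner_cong:
  "(\<And>x. x \<in> cube n \<Longrightarrow> f x = f' x) \<Longrightarrow> (\<And>x. x \<in> cube n \<Longrightarrow> g x = g' x) \<Longrightarrow> L2_inner n f g = L2_inner n f' g'"
  unfolding L2_inner_def by (rule expect_cong) simp

lemma L2_inner_add_left:
  "bounded_rv n f \<Longrightarrow> bounded_rv n f' \<Longrightarrow> bounded_rv n g \<Longrightarrow>
    L2_inner n (\<lambda>x. f x + f' x) g = L2_inner n f g + L2_inner n f' g"
  unfolding L2_inner_def distrib_right by (rule expect_add) auto

lemma L2_inner_diff_left:
  "bounded_rv n f \<Longrightarrow> bounded_rv n f' \<Longrightarrow> bounded_rv n g \<Longrightarrow>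
    L2_inner n (\<lambda>x. f x - f' x) g = L2_inner n f g - L2_inner n f' g"
  unfolding L2_inner_def left_diff_distrib by (rule expect_diff) auto

lemma L2_inner_sum_left:
  "(\<And>i. i \<in> I \<Longrightarrow> bounded_rv n (f i)) \<Longrightarrow> bounded_rv n g \<Longrightarrow>
    L2_inner n (\<lambda>x. \<Sum>i\<in>I. f i x) g = (\<Sum>i\<in>I. L2_inner n (f i) g)"
  unfolding L2_inner_def sum_distrib_right by (rule expect_sum) auto

lemma L2_inner_mult_left: "L2_inner n (\<lambda>x. c * f x) g = c * L2_inner n f g"
  by (simp add: L2_inner_def mult.assoc)

lemma L2_inner_const_left: "L2_inner n (\<lambda>x. c) g = c * expect n g"
  by (simp add: L2_inner_def)

lemma avg_coord_linear:
  assumes "bounded_rv n f" "bounded_rv n g" "j < n" "x \<in> cube n"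
  shows "avg_coord j (\<lambda>x. f x + g x) x = avg_coord j f x + avg_coord j g x"
    and "avg_coord j (\<lambda>x. f x - g x) x = avg_coord j f x - avg_coord j g x"
  unfolding avg_coord_def using assms by simp_all

lemma avg_coord_sum:
  assumes "\<And>i. i \<in> I \<Longrightarrow> bounded_rv n (f i)" "j < n" "x \<in> cube n"
  shows "avg_coord j (\<lambda>x. \<Sum>i\<in>I. f i x) x = (\<Sum>i\<in>I. avg_coord j (f i) x)"
  unfolding avg_coord_def using assms by (auto intro!: Bochner_Integration.integral_sum integrable_slice[where n = n])

lemma avg_coord_mult_left: "avg_coord j (\<lambda>x. c * f x) x = c * avg_coord j f x"
  by (simp add: avg_coord_def)

lemma avg_coord_const [simp]: "avg_coord j (\<lambda>x. c) = (\<lambda>x. c)"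
  using unif.prob_space by (simp add: avg_coord_def fun_eq_iff)

lemma monotone_cubeD:
  "monotone_cube n f \<Longrightarrow> x \<in> cube n \<Longrightarrow> y \<in> cube n \<Longrightarrow> (\<And>i. i < n \<Longrightarrow> x i \<le> y i) \<Longrightarrow> f x \<le> f y"
  by (auto simp: monotone_cube_def monotone_on_def)

lemma monotone_cube_avg_coord:
  assumes "monotone_cube n f" "bounded_rv n f" "j < n"
  shows "monotone_cube n (avg_coord j f)"
  unfolding monotone_cube_def monotone_on_def avg_coord_def
proof safe
  fix x y assume xy: "x \<in> cube n" "y \<in> cube n" "\<forall>i<n. x i \<le> y i"
  then show "(\<integral>t. f (x(j := t)) \<partial>unif) \<le> (\<integral>t. f (y(j := t)) \<partial>unif)"
    using assms by (intro integral_mono) (auto intro!: monotone_cubeD[OF assms(1)] fun_upd_cube)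
qed

text \<open>
  Chebyshev's correlation inequality in one coordinate: integrate
  \<open>0 \<le> (f x - f y) (g x - g y)\<close> where \<open>y\<close> is \<open>x\<close> with its \<open>j\<close>-th coordinate resampled.
\<close>

lemma L2_inner_avg_coord_le:
  assumes f: "monotone_cube n f" "bounded_rv n f" and g: "monotone_cube n g" "bounded_rv n g" and j: "j < n"
  shows "L2_inner n (avg_coord j f) g \<le> L2_inner n f g"
proof -
  have "0 \<le> f x * g x - f x * avg_coord j g x - avg_coord j f x * g x + avg_coord j (\<lambda>x. f x * g x) x"
    if x: "x \<in> cube n" for x
  proof -
    have "0 \<le> (\<integral>t. (f x - f (x(j := t))) * (g x - g (x(j := t))) \<partial>unif)"
    proof (rule integral_nonneg_AE, rule AE_I2)
      fix t assume "t \<in> space unif"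
      then have y: "x(j := t) \<in> cube n" using x j by (simp add: fun_upd_cube)
      show "0 \<le> (f x - f (x(j := t))) * (g x - g (x(j := t)))"
      proof (cases "x j \<le> t")
        case True
        then have "f x \<le> f (x(j := t))" "g x \<le> g (x(j := t))"
          using x y by (auto intro!: monotone_cubeD[OF f(1)] monotone_cubeD[OF g(1)])
        then show ?thesis by (simp add: mult_nonpos_nonpos)
      next
        case False
        then have "f (x(j := t)) \<le> f x" "g (x(j := t)) \<le> g x"
          using x y by (auto intro!: monotone_cubeD[OF f(1)] monotone_cubeD[OF g(1)])
        then show ?thesis by simp
      qed
    qed
    also have "\<dots> = (\<integral>t. f x * g x - f x * g (x(j := t)) - f (x(j := t)) * g x + f (x(j := t)) * g (x(j := t)) \<partial>unif)"
      by (simp add: algebra_simps)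
    also have "\<dots> = f x * g x - f x * avg_coord j g x - avg_coord j f x * g x + avg_coord j (\<lambda>x. f x * g x) x"
      using f(2) g(2) x j integrable_slice[OF bounded_rv_mult[OF f(2) g(2)] j x] unif.prob_space
      by (simp add: avg_coord_def)
    finally show ?thesis .
  qed
  then have "expect n (\<lambda>x. 0) \<le> expect n (\<lambda>x. f x * g x - f x * avg_coord j g x - avg_coord j f x * g x
      + avg_coord j (\<lambda>x. f x * g x) x)"
    using f g j by (intro expect_mono) auto
  also have "\<dots> = expect n (\<lambda>x. f x * g x) - expect n (\<lambda>x. f x * avg_coord j g x)
      - expect n (\<lambda>x. avg_coord j f x * g x) + expect n (avg_coord j (\<lambda>x. f x * g x))"
    using f g j by (subst expect_add expect_diff; auto)+
  also have "expect n (avg_coord j (\<lambda>x. f x * g x)) = expect n (\<lambda>x. f x * g x)"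
    using f g j by (intro expect_avg_coord) auto
  \<comment> \<open>By self-adjointness the two cross terms coincide, so the inequality becomes
    twice the claim.\<close>
  also have "expect n (\<lambda>x. f x * avg_coord j g x) = expect n (\<lambda>x. avg_coord j f x * g x)"
    using L2_inner_avg_coord_left[OF f(2) g(2) j] L2_inner_avg_coord_left[OF g(2) f(2) j]
    by (simp add: L2_inner_def mult.commute)
  finally show ?thesis by (simp add: L2_inner_def)
qed

subsection \<open>Noise operators and the Efron-Stein decomposition\<close>

text \<open>
  With \<open>R\<^sub>j\<close> averaging over the \<open>j\<close>-th coordinate, \<open>noise m r\<close> is the product of
  \<open>r I + (1 - r) R\<^sub>j\<close> over \<open>j < m\<close>, and \<open>level_part m k\<close> is its coefficient at \<open>r\<^sup>k\<close>,
  the projection onto the functions of Efron-Stein degree \<open>k\<close> in the first \<open>m\<close> coordinates.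
\<close>

primrec noise :: "nat \<Rightarrow> real \<Rightarrow> ((nat \<Rightarrow> real) \<Rightarrow> real) \<Rightarrow> (nat \<Rightarrow> real) \<Rightarrow> real" where
  "noise 0 r f = f"
| "noise (Suc m) r f = (\<lambda>x. r * noise m r f x + (1 - r) * avg_coord m (noise m r f) x)"

primrec level_part :: "nat \<Rightarrow> nat \<Rightarrow> ((nat \<Rightarrow> real) \<Rightarrow> real) \<Rightarrow> (nat \<Rightarrow> real) \<Rightarrow> real" where
  "level_part 0 k f = (if k = 0 then f else (\<lambda>x. 0))"
| "level_part (Suc m) k f = (\<lambda>x. avg_coord m (level_part m k f) x +
     (if k = 0 then 0 else level_part m (k - 1) f x - avg_coord m (level_part m (k - 1) f) x))"

lemma bounded_rv_noise: "bounded_rv n f \<Longrightarrow> m \<le> n \<Longrightarrow> bounded_rv n (noise m r f)"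
  by (induction m) auto

lemma monotone_cube_noise:
  assumes f: "monotone_cube n f" "bounded_rv n f" and r: "0 \<le> r" "r \<le> 1" and m: "m \<le> n"
  shows "monotone_cube n (noise m r f)"
  using m
proof (induction m)
  case (Suc m)
  then have h: "monotone_cube n (noise m r f)" "bounded_rv n (noise m r f)"
    using f by (auto simp: bounded_rv_noise)
  show ?case
    unfolding monotone_cube_def monotone_on_def
  proof safe
    fix x y assume xy: "x \<in> cube n" "y \<in> cube n" "\<forall>i<n. x i \<le> y i"
    then have "noise m r f x \<le> noise m r f y" "avg_coord m (noise m r f) x \<le> avg_coord m (noise m r f) y"
      using monotone_cubeD[OF h(1)] monotone_cubeD[OF monotone_cube_avg_coord[OF h, of m]] Suc.prems
      by auto
    then show "noise (Suc m) r f x \<le> noise (Suc m) r f y"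
      using r by (auto intro!: add_mono mult_left_mono)
  qed
qed (simp add: f)

text \<open>Each factor of the noise operator is a convex combination of the identity and one
  average, which Chebyshev's inequality compares. It applies at every stage because noise preserves
  monotonicity.\<close>

lemma L2_inner_noise_le:
  assumes f: "monotone_cube n f" "bounded_rv n f" and g: "monotone_cube n g" "bounded_rv n g"
    and r: "0 \<le> r" "r \<le> 1" and m: "m \<le> n"
  shows "L2_inner n (noise m r f) g \<le> L2_inner n f g"
  using m
proof (induction m)
  case (Suc m)
  define h where "h = noise m r f"
  have h: "monotone_cube n h" "bounded_rv n h"
    using f r Suc.prems by (auto simp: h_def bounded_rv_noise monotone_cube_noise)
  have "L2_inner n (noise (Suc m) r f) g = r * L2_inner n h g + (1 - r) * L2_inner n (avg_coord m h) g"
    unfolding noise.simps h_def[symmetric] using h g Suc.prems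
    by (subst L2_inner_add_left) (auto simp: L2_inner_mult_left)
  also have "\<dots> \<le> r * L2_inner n h g + (1 - r) * L2_inner n h g"
    using r L2_inner_avg_coord_le[OF h g, of m] Suc.prems by (intro add_left_mono mult_left_mono) auto
  also have "\<dots> = L2_inner n h g" by (simp add: algebra_simps)
  also have "\<dots> \<le> L2_inner n f g" using Suc by (simp add: h_def)
  finally show ?case .
qed simp

lemma expect_noise:
  assumes "bounded_rv n f" "m \<le> n"
  shows "expect n (noise m r f) = expect n f"
  using assms(2)
proof (induction m)
  case (Suc m)
  then have h: "bounded_rv n (noise m r f)" using assms by (simp add: bounded_rv_noise)
  have "expect n (noise (Suc m) r f) = r * expect n (noise m r f) + (1 - r) * expect n (avg_coord m (noise m r f))"
    unfolding noise.simps using h Suc.prems by (subst expect_add) auto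
  also have "\<dots> = expect n f"
    using Suc expect_avg_coord[OF h, of m] by (simp add: algebra_simps)
  finally show ?case .
qed simp

lemma level_part_gt: "m < k \<Longrightarrow> level_part m k f = (\<lambda>x. 0)"
  by (induction m arbitrary: k) auto

lemma bounded_rv_level_part: "bounded_rv n f \<Longrightarrow> m \<le> n \<Longrightarrow> bounded_rv n (level_part m k f)"
  by (induction m arbitrary: k) auto

text \<open>Each factor \<open>r I + (1 - r) R\<close> equals \<open>R + r (I - R)\<close>, so only
  the part \<open>I - R\<close> raises the degree in \<open>r\<close>, matching the recursion of
  \<open>level_part\<close>.\<close>

lemma noise_eq_sum_level_part:
  assumes f: "bounded_rv n f" and "m \<le> n" "x \<in> cube n"
  shows "noise m r f x = (\<Sum>k\<le>m. r ^ k * level_part m k f x)"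
  using assms(2,3)
proof (induction m arbitrary: x)
  case (Suc m)
  let ?Q = "\<lambda>k. level_part m k f"
  have b: "bounded_rv n (?Q k)" for k using f Suc.prems by (simp add: bounded_rv_level_part)
  have "avg_coord m (noise m r f) x = avg_coord m (\<lambda>x. \<Sum>k\<le>m. r ^ k * ?Q k x) x"
    using Suc by (intro avg_coord_cong[where n = n]) auto
  also have "\<dots> = (\<Sum>k\<le>m. r ^ k * avg_coord m (?Q k) x)"
    using Suc.prems b by (subst avg_coord_sum[where n = n]) (auto simp: avg_coord_mult_left)
  finally have R: "avg_coord m (noise m r f) x = (\<Sum>k\<le>m. r ^ k * avg_coord m (?Q k) x)" .
  have "noise (Suc m) r f x
      = r * (\<Sum>k\<le>m. r ^ k * ?Q k x) + (1 - r) * (\<Sum>k\<le>m. r ^ k * avg_coord m (?Q k) x)"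
    using Suc by (simp add: R)
  also have "\<dots> = (\<Sum>k\<le>m. r ^ k * avg_coord m (?Q k) x)
      + (\<Sum>k\<le>m. r ^ Suc k * (?Q k x - avg_coord m (?Q k) x))"
    by (simp add: sum_distrib_left sum_subtractf right_diff_distrib left_diff_distrib mult.assoc)
  \<comment> \<open>The added summand vanishes: \<open>m\<close> coordinates carry no part of level
    \<open>Suc m\<close>.\<close>
  also have "(\<Sum>k\<le>m. r ^ k * avg_coord m (?Q k) x) = (\<Sum>k\<le>Suc m. r ^ k * avg_coord m (?Q k) x)"
    by (simp add: level_part_gt)
  also have "(\<Sum>k\<le>m. r ^ Suc k * (?Q k x - avg_coord m (?Q k) x))
      = (\<Sum>k\<le>Suc m. r ^ k * (if k = 0 then 0 else ?Q (k - 1) x - avg_coord m (?Q (k - 1)) x))"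
    by (subst sum.atMost_Suc_shift) simp
  finally show ?case
    by (simp add: distrib_left sum.distrib del: sum.atMost_Suc)
qed simp

text \<open>\<open>R\<close> and \<open>I - R\<close> have orthogonal ranges. Level \<open>k\<close>
  splits into energies \<open>A k\<close> and \<open>D k\<close>, and the recursion only regroups
  them as \<open>A k + D (k - 1)\<close>, so the total is preserved.\<close>

lemma sum_level_part_square:
  assumes f: "bounded_rv n f" and "m \<le> n"
  shows "(\<Sum>k\<le>m. L2_inner n (level_part m k f) (level_part m k f)) = L2_inner n f f"
  using assms(2)
proof (induction m)
  case (Suc m)
  let ?Q = "\<lambda>k. level_part m k f"
  let ?N = "\<lambda>u. L2_inner n u u"
  define A where "A k = ?N (avg_coord m (?Q k))" for k
  define D where "D k = ?N (\<lambda>x. ?Q k x - avg_coord m (?Q k) x)" for k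
  have m: "m < n" using Suc.prems by simp
  have b: "bounded_rv n (?Q k)" for k using f Suc.prems by (simp add: bounded_rv_level_part)
  \<comment> \<open>Two different functions are allowed since the new level \<open>k\<close>
    combines the old levels \<open>k\<close> and \<open>k - 1\<close>.\<close>
  have pyth: "?N (\<lambda>x. avg_coord m u x + (v x - avg_coord m v x))
      = ?N (avg_coord m u) + ?N (\<lambda>x. v x - avg_coord m v x)"
    if u: "bounded_rv n u" and v: "bounded_rv n v" for u v
  proof -
    let ?w = "\<lambda>x. v x - avg_coord m v x"
    have "L2_inner n (avg_coord m u) ?w = 0"
      using u v m L2_inner_avg_coord_left[OF v u m] L2_inner_avg_coord_left[OF u v m]
      by (subst L2_inner_commute, subst L2_inner_diff_left) (auto simp: L2_inner_commute)
    moreover have "?N (\<lambda>x. avg_coord m u x + ?w x)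
        = ?N (avg_coord m u) + L2_inner n (avg_coord m u) ?w + (L2_inner n (avg_coord m u) ?w + ?N ?w)"
      using u v m
      by (subst L2_inner_add_left; (subst (1 2) L2_inner_commute)?; (subst (1 2) L2_inner_add_left)?; auto simp: L2_inner_commute)
    ultimately show ?thesis by simp
  qed
  have split: "?N (?Q k) = A k + D k" for k
    using pyth[OF b b, of k k] by (simp add: A_def D_def)
  have "?N (level_part (Suc m) k f) = A k + (if k = 0 then 0 else D (k - 1))" for k
    using pyth[OF b b, of k "k - 1"] by (simp add: A_def D_def)
  then have "(\<Sum>k\<le>Suc m. ?N (level_part (Suc m) k f))
      = (\<Sum>k\<le>Suc m. A k) + (\<Sum>k\<le>Suc m. if k = 0 then 0 else D (k - 1))"
    by (simp only: sum.distrib)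
  also have "(\<Sum>k\<le>Suc m. if k = 0 then 0 else D (k - 1)) = (\<Sum>k\<le>m. D k)"
    by (subst sum.atMost_Suc_shift) simp
  also have "(\<Sum>k\<le>Suc m. A k) = (\<Sum>k\<le>m. A k)"
    by (simp add: A_def level_part_gt L2_inner_def)
  also have "(\<Sum>k\<le>m. A k) + (\<Sum>k\<le>m. D k) = ?N f"
    using Suc by (simp add: split sum.distrib)
  finally show ?case .
qed simp

lemma L2_inner_self_nonneg: "0 \<le> L2_inner n f f"
  unfolding L2_inner_def expect_def by (intro integral_nonneg_AE AE_I2) simp

lemma level_part_contraction:
  assumes "bounded_rv n f" "m \<le> n"
  shows "L2_inner n (level_part m k f) (level_part m k f) \<le> L2_inner n f f"
proof (cases "k \<le> m")
  case True
  then show ?thesis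
    unfolding sum_level_part_square[OF assms, symmetric]
    by (intro member_le_sum) (auto simp: L2_inner_self_nonneg)
next
  case False
  then show ?thesis
    using L2_inner_self_nonneg[of n f] by (simp add: level_part_gt L2_inner_const_left)
qed

text \<open>AM-GM in place of Cauchy-Schwarz; with both norms at most 1 it gives the same bound
  1.\<close>

lemma abs_L2_inner_le:
  assumes "bounded_rv n f" "bounded_rv n g"
  shows "\<bar>L2_inner n f g\<bar> \<le> (L2_inner n f f + L2_inner n g g) / 2"
proof -
  have "\<bar>L2_inner n f g\<bar> \<le> expect n (\<lambda>x. \<bar>f x * g x\<bar>)"
    unfolding L2_inner_def expect_def by (rule integral_abs_bound)
  also have "\<dots> \<le> expect n (\<lambda>x. (f x * f x + g x * g x) * (1 / 2))"
  proof (rule expect_mono)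
    obtain B where "\<And>x. x \<in> cube n \<Longrightarrow> \<bar>f x * g x\<bar> \<le> B"
      using bounded_rv_bound[OF bounded_rv_mult[OF assms]] by metis
    then show "bounded_rv n (\<lambda>x. \<bar>f x * g x\<bar>)"
      using bounded_rv_measurable[OF bounded_rv_mult[OF assms]] by (intro bounded_rvI[where B = B]) auto
    fix x
    show "\<bar>f x * g x\<bar> \<le> (f x * f x + g x * g x) * (1 / 2)"
      using sum_squares_bound[of "\<bar>f x\<bar>" "\<bar>g x\<bar>"] by (simp add: abs_mult power2_eq_square)
  qed (use assms in auto)
  also have "\<dots> = (L2_inner n f f + L2_inner n g g) / 2"
    unfolding expect_mult_right L2_inner_def using assms by (subst expect_add) auto
  finally show ?thesis .
qed

section \<open>Averaging over sets of coordinates; levels 0 and 1\<close>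

definition mix :: "nat set \<Rightarrow> (nat \<Rightarrow> real) \<Rightarrow> (nat \<Rightarrow> real) \<Rightarrow> nat \<Rightarrow> real" where
  "mix A x y = (\<lambda>k. if k \<in> A then y k else x k)"

definition avg :: "nat \<Rightarrow> nat set \<Rightarrow> ((nat \<Rightarrow> real) \<Rightarrow> real) \<Rightarrow> (nat \<Rightarrow> real) \<Rightarrow> real" where
  "avg n A f x = expect n (\<lambda>y. f (mix A x y))"

lemma mix_cube: "x \<in> cube n \<Longrightarrow> y \<in> cube n \<Longrightarrow> mix A x y \<in> cube n"
  by (auto simp: mix_def cube_def PiE_iff extensional_def)

lemma measurable_mix: "(\<lambda>(x, y). mix A x y) \<in> measurable (unif_cube n \<Otimes>\<^sub>M unif_cube n) (unif_cube n)"
proof -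
  have "(\<lambda>z k. mix A (fst z) (snd z) k) \<in> measurable (unif_cube n \<Otimes>\<^sub>M unif_cube n) (Pi\<^sub>M {..<n} (\<lambda>_. unif))"
  proof (rule measurable_PiM_single')
    fix k assume "k \<in> {..<n}"
    then have "(\<lambda>x. x k) \<in> measurable (unif_cube n) unif"
      unfolding unif_cube_eq by (rule measurable_component_singleton)
    then show "(\<lambda>z. mix A (fst z) (snd z) k) \<in> measurable (unif_cube n \<Otimes>\<^sub>M unif_cube n) unif"
      by (cases "k \<in> A") (auto simp: mix_def)
  next
    have "(\<lambda>z. mix A (fst z) (snd z)) \<in> space (unif_cube n \<Otimes>\<^sub>M unif_cube n) \<rightarrow> cube n"
      using mix_cube by (auto simp: space_pair_measure space_unif_cube)
    then show "(\<lambda>z k. mix A (fst z) (snd z) k) \<in> space (unif_cube n \<Otimes>\<^sub>M unif_cube n) \<rightarrow> (\<Pi>\<^sub>E i\<in>{..<n}. space unif)"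
      by (simp add: cube_def)
  qed
  then show ?thesis by (simp add: case_prod_beta' unif_cube_eq)
qed

lemma measurable_mix_comp:
  assumes "bounded_rv n f"
  shows "(\<lambda>(x, y). f (mix A x y)) \<in> borel_measurable (unif_cube n \<Otimes>\<^sub>M unif_cube n)"
  using measurable_comp[OF measurable_mix bounded_rv_measurable[OF assms]]
  by (simp add: comp_def case_prod_beta')

lemma bounded_rv_mix:
  assumes "bounded_rv n f" "x \<in> cube n"
  shows "bounded_rv n (\<lambda>y. f (mix A x y))"
proof -
  obtain B where "\<And>x. x \<in> cube n \<Longrightarrow> \<bar>f x\<bar> \<le> B"
    using assms bounded_rv_bound by metis
  moreover have "(\<lambda>y. f (mix A x y)) \<in> borel_measurable (unif_cube n)"
    using measurable_Pair2[OF measurable_mix_comp[OF assms(1)], of x] assms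
    by (simp add: space_unif_cube)
  ultimately show ?thesis
    using mix_cube assms by (intro bounded_rvI[where B = B]) auto
qed

lemma bounded_rv_avg:
  assumes "bounded_rv n f"
  shows "bounded_rv n (avg n A f)"
proof -
  obtain B where B: "\<And>x. x \<in> cube n \<Longrightarrow> \<bar>f x\<bar> \<le> B"
    using assms bounded_rv_bound by metis
  show ?thesis
  proof (rule bounded_rvI)
    show "avg n A f \<in> borel_measurable (unif_cube n)"
      unfolding avg_def expect_def
      using measurable_mix_comp[OF assms] by (intro unif_cube.borel_measurable_lebesgue_integral) auto
    fix x assume x: "x \<in> cube n"
    have "expect n (\<lambda>y. f (mix A x y)) \<le> expect n (\<lambda>y. B)" "expect n (\<lambda>y. - B) \<le> expect n (\<lambda>y. f (mix A x y))"
      using B[OF mix_cube[OF x]] bounded_rv_mix[OF assms x]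
      by (auto intro!: expect_mono simp: abs_le_iff minus_le_iff simp del: expect_const)
    then show "\<bar>avg n A f x\<bar> \<le> B" by (simp add: avg_def abs_le_iff minus_le_iff)
  qed
qed

lemma avg_empty: "avg n {} f = f"
  by (rule ext) (simp add: avg_def mix_def)

lemma avg_coord_avg:
  assumes "bounded_rv n f" "j < n" "j \<notin> A" "x \<in> cube n"
  shows "avg_coord j (avg n A f) x = avg n (insert j A) f x"
proof -
  have "mix (insert j A) x (y(j := t)) = mix A (x(j := t)) y" for y t
    using assms(3) by (auto simp: mix_def fun_eq_iff)
  then show ?thesis
    unfolding avg_coord_def avg_def
    using expect_disintegrate[OF bounded_rv_mix[OF assms(1,4), of "insert j A"] assms(2)] by simp
qed

text \<open>Points of the cube share the value \<open>undefined\<close> outside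
  \<open>{..<n}\<close>, so mixing over all of \<open>{..<n}\<close> returns \<open>y\<close>
  itself.\<close>

lemma avg_all: "x \<in> cube n \<Longrightarrow> avg n {..<n} f x = expect n f"
  unfolding avg_def
  by (intro expect_cong arg_cong[where f = f]) (auto simp: mix_def cube_def PiE_iff extensional_def fun_eq_iff)

lemma noise_0_eq_avg:
  assumes "bounded_rv n f" "m \<le> n" "x \<in> cube n"
  shows "noise m 0 f x = avg n {..<m} f x"
  using assms(2,3)
proof (induction m arbitrary: x)
  case (Suc m)
  then have "noise (Suc m) 0 f x = avg_coord m (avg n {..<m} f) x"
    by (simp cong: avg_coord_cong)
       (auto intro!: avg_coord_cong[where n = n])
  then show ?case using avg_coord_avg[OF assms(1), of m "{..<m}" x] Suc.prems by (simp add: lessThan_Suc)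
qed (simp add: avg_empty)

text \<open>Harris' inequality: the noise operator at \<open>r = 0\<close> resamples every
  coordinate and so replaces \<open>f\<close> by its mean.\<close>

lemma expect_mult_le:
  assumes f: "monotone_cube n f" "bounded_rv n f" and g: "monotone_cube n g" "bounded_rv n g"
  shows "expect n f * expect n g \<le> L2_inner n f g"
proof -
  have "L2_inner n (noise n 0 f) g = L2_inner n (\<lambda>x. expect n f) g"
    using f by (intro L2_inner_cong) (auto simp: noise_0_eq_avg avg_all)
  then show ?thesis
    using L2_inner_noise_le[OF f g, of 0 n] by (simp add: L2_inner_const_left)
qed

text \<open>The constant term of the noise polynomial, read off at \<open>r = 0\<close>.\<close>

lemma level_part_0:
  assumes "bounded_rv n f" "m \<le> n" "x \<in> cube n"
  shows "level_part m 0 f x = avg n {..<m} f x"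
  using noise_eq_sum_level_part[OF assms, of 0] noise_0_eq_avg[OF assms]
  by (simp add: power_0_left if_distrib[of "\<lambda>c. c * _"] cong: if_cong)

text \<open>The main effects of the ANOVA decomposition. Passing to \<open>Suc m\<close> averages
  the old effects over coordinate \<open>m\<close> as well and adds the effect of \<open>m\<close>,
  which comes from level 0.\<close>

lemma level_part_1:
  assumes "bounded_rv n f" "m \<le> n" "x \<in> cube n"
  shows "level_part m 1 f x = (\<Sum>i<m. avg n ({..<m} - {i}) f x - avg n {..<m} f x)"
  using assms(2,3)
proof (induction m arbitrary: x)
  case (Suc m)
  have m: "m < n" using Suc.prems by simp
  have "avg_coord m (level_part m 1 f) x
      = avg_coord m (\<lambda>x. \<Sum>i<m. avg n ({..<m} - {i}) f x - avg n {..<m} f x) x"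
    using Suc by (intro avg_coord_cong[where n = n]) auto
  also have "\<dots> = (\<Sum>i<m. avg_coord m (avg n ({..<m} - {i}) f) x - avg_coord m (avg n {..<m} f) x)"
    using assms(1) Suc.prems bounded_rv_avg[OF assms(1)]
    by (subst avg_coord_sum[where n = n]) (auto intro!: sum.cong simp: avg_coord_linear[where n = n])
  also have "\<dots> = (\<Sum>i<m. avg n ({..<Suc m} - {i}) f x - avg n {..<Suc m} f x)"
  proof (intro sum.cong refl arg_cong2[where f = "(-)"])
    fix i assume "i \<in> {..<m}"
    then have "insert m ({..<m} - {i}) = {..<Suc m} - {i}" by auto
    then show "avg_coord m (avg n ({..<m} - {i}) f) x = avg n ({..<Suc m} - {i}) f x"
      using avg_coord_avg[OF assms(1) m, of "{..<m} - {i}" x] Suc.prems by simp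
    show "avg_coord m (avg n {..<m} f) x = avg n {..<Suc m} f x"
      using avg_coord_avg[OF assms(1) m, of "{..<m}" x] Suc.prems by (simp add: lessThan_Suc)
  qed
  finally have R: "avg_coord m (level_part m 1 f) x = (\<Sum>i<m. avg n ({..<Suc m} - {i}) f x - avg n {..<Suc m} f x)" .
  have "{..<Suc m} - {m} = {..<m}" by auto
  then have "level_part m 0 f x = avg n ({..<Suc m} - {m}) f x"
    using Suc.prems assms(1) by (simp add: level_part_0)
  moreover have "avg_coord m (level_part m 0 f) x = avg n {..<Suc m} f x"
    using avg_coord_cong[of n "level_part m 0 f" "avg n {..<m} f" m x] level_part_0[OF assms(1)]
      avg_coord_avg[OF assms(1) m, of "{..<m}" x] Suc.prems by (simp add: lessThan_Suc)
  ultimately show ?case using R by simp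
qed simp

section \<open>Marginals: conditional expectations given one coordinate\<close>

definition marginal :: "nat \<Rightarrow> nat \<Rightarrow> ((nat \<Rightarrow> real) \<Rightarrow> real) \<Rightarrow> real \<Rightarrow> real" where
  "marginal n i f t = expect n (\<lambda>y. f (y(i := t)))"

lemma avg_all_but_one:
  assumes "x \<in> cube n" "i < n"
  shows "avg n ({..<n} - {i}) f x = marginal n i f (x i)"
  unfolding avg_def marginal_def using assms
  by (intro expect_cong arg_cong[where f = f]) (auto simp: mix_def cube_def PiE_iff extensional_def fun_eq_iff)

lemma integral_marginal_mult:
  assumes "bounded_rv n f" "i < n" "bounded_rv n (\<lambda>x. h (x i))"
  shows "L2_inner n f (\<lambda>x. h (x i)) = (\<integral>t. marginal n i f t * h t \<partial>unif)"
  unfolding L2_inner_def marginal_def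
  using assms by (subst expect_disintegrate[where j = i]) auto

lemma level_part_1_inner:
  assumes f: "bounded_rv n f" and g: "bounded_rv n g"
  shows "L2_inner n (level_part n 1 f) g
    = (\<Sum>i<n. L2_inner n (avg n ({..<n} - {i}) f) g - expect n f * expect n g)"
proof -
  have "L2_inner n (level_part n 1 f) g = L2_inner n (\<lambda>x. \<Sum>i<n. avg n ({..<n} - {i}) f x - expect n f) g"
    using f by (intro L2_inner_cong) (auto simp only: level_part_1 avg_all)
  also have "\<dots> = (\<Sum>i<n. L2_inner n (\<lambda>x. avg n ({..<n} - {i}) f x - expect n f) g)"
    using f g by (intro L2_inner_sum_left) (auto simp: bounded_rv_avg)
  also have "\<dots> = (\<Sum>i<n. L2_inner n (avg n ({..<n} - {i}) f) g - expect n f * expect n g)"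
    using f g
    by (intro sum.cong refl, subst L2_inner_diff_left) (auto simp: bounded_rv_avg L2_inner_const_left)
  finally show ?thesis .
qed

lemma avg_inner_eq_marginals:
  assumes f: "bounded_rv n f" and g: "bounded_rv n g" and i: "i < n"
  shows "L2_inner n (avg n ({..<n} - {i}) f) g = (\<integral>t. marginal n i f t * marginal n i g t \<partial>unif)"
proof -
  \<comment> \<open>Inherited from \<open>avg\<close>, with which this function agrees on the
    cube.\<close>
  have "bounded_rv n (\<lambda>x. marginal n i f (x i))"
    using bounded_rv_avg[OF f, of "{..<n} - {i}"] i
      bounded_rv_cong[of n "avg n ({..<n} - {i}) f" "\<lambda>x. marginal n i f (x i)"]
    by (simp add: avg_all_but_one)
  from integral_marginal_mult[OF g i this]
  have "L2_inner n g (\<lambda>x. marginal n i f (x i)) = (\<integral>t. marginal n i f t * marginal n i g t \<partial>unif)"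
    by (simp add: mult.commute)
  moreover have "L2_inner n (avg n ({..<n} - {i}) f) g = L2_inner n (\<lambda>x. marginal n i f (x i)) g"
    using i by (intro L2_inner_cong) (auto simp: avg_all_but_one)
  ultimately show ?thesis by (simp add: L2_inner_commute)
qed

lemma integral_marginal:
  assumes "bounded_rv n f" "i < n"
  shows "(\<integral>t. marginal n i f t \<partial>unif) = expect n f"
  using expect_disintegrate[OF assms] by (simp add: marginal_def)

lemma expect_avg:
  assumes f: "bounded_rv n f" and i: "i < n"
  shows "expect n (avg n ({..<n} - {i}) f) = expect n f"
proof -
  have "expect n (avg n ({..<n} - {i}) f) = L2_inner n (avg n ({..<n} - {i}) f) (\<lambda>x. 1)"
    by (simp add: L2_inner_def)
  also have "\<dots> = (\<integral>t. marginal n i f t \<partial>unif)"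
    using avg_inner_eq_marginals[OF f bounded_rv_const i, of 1] by (simp add: marginal_def)
  finally show ?thesis using integral_marginal[OF f i] by simp
qed

lemma monotone_cube_avg:
  assumes "monotone_cube n f" "bounded_rv n f"
  shows "monotone_cube n (avg n A f)"
  unfolding monotone_cube_def monotone_on_def avg_def
proof safe
  fix x y assume xy: "x \<in> cube n" "y \<in> cube n" "\<forall>i<n. x i \<le> y i"
  then show "expect n (\<lambda>z. f (mix A x z)) \<le> expect n (\<lambda>z. f (mix A y z))"
    using assms
    by (intro expect_mono bounded_rv_mix monotone_cubeD[OF assms(1)] mix_cube) (auto simp: mix_def)
qed

text \<open>Each summand is the covariance of \<open>g\<close> with a conditional expectation of
  \<open>f\<close>, which is again monotone and has the mean of \<open>f\<close>; Harris' inequality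
  applies.\<close>

lemma level_one_nonneg:
  assumes f: "monotone_cube n f" "bounded_rv n f" and g: "monotone_cube n g" "bounded_rv n g"
  shows "0 \<le> L2_inner n (level_part n 1 f) g"
proof -
  have "0 \<le> L2_inner n (avg n ({..<n} - {i}) f) g - expect n f * expect n g" if "i < n" for i
    using expect_mult_le[OF monotone_cube_avg[OF f] bounded_rv_avg[OF f(2)] g, of "{..<n} - {i}"]
      expect_avg[OF f(2) that] by simp
  then show ?thesis
    unfolding level_part_1_inner[OF f(2) g(2)] by (intro sum_nonneg) auto
qed

lemma abs_level_part_inner_le:
  assumes "bounded_rv n f" "bounded_rv n g" "L2_inner n f f \<le> 1" "L2_inner n g g \<le> 1"
  shows "\<bar>L2_inner n (level_part n k f) g\<bar> \<le> 1"
  using abs_L2_inner_le[OF bounded_rv_level_part[OF assms(1) order_refl, of k] assms(2)]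
    level_part_contraction[OF assms(1) order_refl, of k] assms(3,4) by simp

lemma level_one_le_covariance:
  assumes f: "monotone_cube n f" "bounded_rv n f" and g: "monotone_cube n g" "bounded_rv n g"
    and norm: "L2_inner n f f \<le> 1" "L2_inner n g g \<le> 1" and n: "n \<ge> 1" and d: "d \<ge> 1"
  shows "L2_inner n (level_part n 1 f) g
    \<le> 8 * (real d)\<^sup>2 * ((L2_inner n f g - expect n f * expect n g) + (1 / 2) ^ d)"
proof -
  define a where "a k = L2_inner n (level_part n k f) g" for k
  have a: "\<bar>a k\<bar> \<le> 1" for k
    unfolding a_def using f(2) g(2) norm by (rule abs_level_part_inner_le)
  have q: "L2_inner n (noise n r f) g = (\<Sum>k\<le>n. a k * r ^ k)" for r
  proof -
    have "L2_inner n (noise n r f) g = L2_inner n (\<lambda>x. \<Sum>k\<le>n. r ^ k * level_part n k f x) g"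
      using f by (intro L2_inner_cong) (auto simp: noise_eq_sum_level_part)
    also have "\<dots> = (\<Sum>k\<le>n. a k * r ^ k)"
      using f g by (subst L2_inner_sum_left) (auto simp: bounded_rv_level_part L2_inner_mult_left a_def mult.commute)
    finally show ?thesis .
  qed
  have a0: "a 0 = expect n f * expect n g"
  proof -
    have "a 0 = L2_inner n (\<lambda>x. expect n f) g"
      unfolding a_def using f by (intro L2_inner_cong) (auto simp only: level_part_0 avg_all)
    then show ?thesis by (simp add: L2_inner_const_left)
  qed
  \<comment> \<open>Below, Harris' inequality for the noisy function, whose mean is that of
    \<open>f\<close>; above, \<open>L2_inner_noise_le\<close>.\<close>
  have "\<bar>\<Sum>k = 1..n. a k * r ^ k\<bar> \<le> L2_inner n f g - expect n f * expect n g" if r: "0 \<le> r" "r \<le> 1" for r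
  proof -
    have "(\<Sum>k\<le>n. a k * r ^ k) = a 0 + (\<Sum>k = 1..n. a k * r ^ k)"
      by (simp add: sum.atMost_shift sum.atLeast1_atMost_eq lessThan_Suc_atMost)
    then have "(\<Sum>k = 1..n. a k * r ^ k) = L2_inner n (noise n r f) g - expect n f * expect n g"
      by (simp add: q a0)
    moreover have "expect n f * expect n g \<le> L2_inner n (noise n r f) g"
      using expect_mult_le[OF monotone_cube_noise[OF f r order_refl] bounded_rv_noise[OF f(2) order_refl] g]
        expect_noise[OF f(2) order_refl, of r] by simp
    moreover have "L2_inner n (noise n r f) g \<le> L2_inner n f g"
      using L2_inner_noise_le[OF f g r order_refl] .
    ultimately show ?thesis by simp
  qed
  from linear_coeff_le[of a, OF a this n d] show ?thesis
    by (simp add: a_def)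
qed

subsection \<open>The first level in the cosine basis\<close>

text \<open>Continuity refers to the topology of all functions on \<open>nat\<close>, the measure to
  a product over \<open>{..<n}\<close>. The identity between them is measurable coordinatewise:
  coordinates from \<open>n\<close> on are constantly \<open>undefined\<close> on the cube.\<close>

lemma borel_measurable_continuous_cube:
  fixes f :: "(nat \<Rightarrow> real) \<Rightarrow> real"
  assumes "continuous_on (cube n) f"
  shows "f \<in> borel_measurable (unif_cube n)"
proof -
  have "(\<lambda>x :: nat \<Rightarrow> real. x) \<in> borel_measurable (unif_cube n)"
  proof (rule measurable_coordinatewise_then_product)
    fix i
    show "(\<lambda>x. x i) \<in> borel_measurable (unif_cube n)"
    proof (cases "i < n")
      case True
      then have "(\<lambda>x. x i) \<in> measurable (unif_cube n) unif"
        unfolding unif_cube_eq by (intro measurable_component_singleton) simp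
      moreover have "(\<lambda>t. t) \<in> borel_measurable unif"
        by (intro borel_measurable_integrable integrable_unif_continuous continuous_intros)
      ultimately show ?thesis by (rule measurable_compose)
    next
      case False
      then have "(\<lambda>x. x i) \<in> borel_measurable (unif_cube n) \<longleftrightarrow>
          (\<lambda>x :: nat \<Rightarrow> real. undefined :: real) \<in> borel_measurable (unif_cube n)"
        by (intro measurable_cong) (auto simp: space_unif_cube cube_def PiE_iff extensional_def)
      then show ?thesis by simp
    qed
  qed
  then have "(\<lambda>x :: nat \<Rightarrow> real. x) \<in> measurable (unif_cube n) (restrict_space borel (cube n))"
    by (intro measurable_restrict_space2) (auto simp: space_unif_cube)
  from measurable_compose[OF this borel_measurable_continuous_on_restrict[OF assms]]
  show ?thesis .
qed

text \<open>Monotonicity places all values between those at the corners (0,...,0) and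
  (1,...,1).\<close>

lemma bounded_rv_monotone_continuous:
  assumes "monotone_cube n f" "continuous_on (cube n) f"
  shows "bounded_rv n f"
proof (rule bounded_rvI)
  let ?c = "\<lambda>c i. if i < n then c else (undefined :: real)"
  fix x assume x: "x \<in> cube n"
  have c: "?c 0 \<in> cube n" "?c 1 \<in> cube n"
    by (auto simp: cube_def PiE_iff extensional_def)
  have "f (?c 0) \<le> f x" "f x \<le> f (?c 1)"
    using x c by (auto intro!: monotone_cubeD[OF assms(1)]) (auto simp: cube_def PiE_iff)
  then show "\<bar>f x\<bar> \<le> \<bar>f (?c 0)\<bar> + \<bar>f (?c 1)\<bar>" by linarith
qed (rule borel_measurable_continuous_cube[OF assms(2)])

lemma continuous_on_slice:
  assumes "continuous_on (cube n) f" "i < n" "y \<in> cube n"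
  shows "continuous_on {0..1} (\<lambda>t. f (y(i := t)))"
proof (rule continuous_on_compose2[OF assms(1)])
  show "continuous_on {0..1} (\<lambda>t. y(i := t))"
  proof (rule continuous_on_coordinatewise_then_product)
    fix k
    show "continuous_on {0..1} (\<lambda>t. (y(i := t)) k)"
      by (cases "k = i") (auto intro: continuous_intros)
  qed
qed (use assms fun_upd_cube in auto)

text \<open>Dominated convergence along sequences, with the constant bound of \<open>f\<close> as
  majorant.\<close>

lemma continuous_on_marginal:
  assumes f: "continuous_on (cube n) f" "bounded_rv n f" and i: "i < n"
  shows "continuous_on {0..1} (marginal n i f)"
  unfolding continuous_on_sequentially
proof (intro allI ballI impI)
  fix u :: "nat \<Rightarrow> real" and a :: real
  assume a: "a \<in> {0..1}" and u: "(\<forall>k. u k \<in> {0..1}) \<and> u \<longlonglongrightarrow> a"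
  obtain B where B: "\<And>x. x \<in> cube n \<Longrightarrow> \<bar>f x\<bar> \<le> B"
    using f bounded_rv_bound by metis
  have meas: "(\<lambda>y. f (y(i := t))) \<in> borel_measurable (unif_cube n)" if "t \<in> {0..1}" for t
    using measurable_Pair1[OF measurable_fun_upd_slice[OF f(2) i], of t] that by simp
  have "(\<lambda>k. \<integral>y. f (y(i := u k)) \<partial>unif_cube n) \<longlonglongrightarrow> (\<integral>y. f (y(i := a)) \<partial>unif_cube n)"
  proof (rule integral_dominated_convergence[where w = "\<lambda>_. B"])
    show "AE y in unif_cube n. (\<lambda>k. f (y(i := u k))) \<longlonglongrightarrow> f (y(i := a))"
    proof (rule AE_I2)
      fix y assume "y \<in> space (unif_cube n)"
      then have "continuous_on {0..1} (\<lambda>t. f (y(i := t)))"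
        using continuous_on_slice[OF f(1) i] by (simp add: space_unif_cube)
      from continuous_on_tendsto_compose[OF this conjunct2[OF u] a]
      show "(\<lambda>k. f (y(i := u k))) \<longlonglongrightarrow> f (y(i := a))"
        using u by simp
    qed
    show "AE y in unif_cube n. norm (f (y(i := u k))) \<le> B" for k
      using B fun_upd_cube[OF _ i] u by (intro AE_I2) (simp add: space_unif_cube)
  qed (use meas a u in auto)
  then show "(marginal n i f \<circ> u) \<longlonglongrightarrow> marginal n i f a"
    by (simp add: comp_def marginal_def expect_def)
qed

section \<open>Level-one multi-indices as pairs of coordinate and frequency\<close>

definition single_index :: "nat \<Rightarrow> nat \<times> nat \<Rightarrow> nat \<Rightarrow> nat" where
  "single_index n = (\<lambda>(i, k). \<lambda>j\<in>{..<n}. if j = i then k else 0)"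

lemma index_support_single_index:
  assumes "i < n" "k \<noteq> 0"
  shows "index_support n (single_index n (i, k)) = {i}"
  using assms by (auto simp: index_support_def single_index_def)

text \<open>Turns the level-one sum into one Parseval sum per coordinate. Surjectivity uses that
  multi-indices are extensional, so the single nonzero entry determines them.\<close>

lemma bij_betw_single_index: "bij_betw (single_index n) ({..<n} \<times> (UNIV - {0})) (level_one n)"
  unfolding bij_betw_def
proof
  show "inj_on (single_index n) ({..<n} \<times> (UNIV - {0}))"
  proof (rule inj_onI)
    fix p q :: "nat \<times> nat"
    assume p: "p \<in> {..<n} \<times> (UNIV - {0})" and q: "q \<in> {..<n} \<times> (UNIV - {0})"
      and eq: "single_index n p = single_index n q"
    obtain i k j l where pq: "p = (i, k)" "q = (j, l)" by fastforce
    have "i = j"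
      using p q index_support_single_index[of i n k] index_support_single_index[of j n l] eq pq by auto
    moreover have "k = l"
      using fun_cong[OF eq, of i] p q pq \<open>i = j\<close> by (simp add: single_index_def)
    ultimately show "p = q" using pq by simp
  qed
  show "single_index n ` ({..<n} \<times> (UNIV - {0})) = level_one n"
  proof (intro equalityI subsetI)
    fix \<alpha> assume "\<alpha> \<in> single_index n ` ({..<n} \<times> (UNIV - {0}))"
    then obtain i k where ik: "i < n" "k \<noteq> 0" "\<alpha> = single_index n (i, k)" by auto
    then have "\<alpha> \<in> multi_indices n" by (auto simp: multi_indices_def single_index_def)
    then show "\<alpha> \<in> level_one n"
      using index_support_single_index[OF ik(1,2)] ik(3) by (simp add: level_one_def)
  next
    fix \<alpha> assume "\<alpha> \<in> level_one n"
    then have \<alpha>: "\<alpha> \<in> extensional {..<n}" "card (index_support n \<alpha>) = 1"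
      by (auto simp: level_one_def multi_indices_def PiE_iff)
    then obtain i where i: "index_support n \<alpha> = {i}" by (auto simp: card_1_singleton_iff)
    then have "i \<in> index_support n \<alpha>" "\<And>j. j \<noteq> i \<Longrightarrow> j \<notin> index_support n \<alpha>"
      by auto
    then have i': "i < n" "\<alpha> i \<noteq> 0" "\<And>j. j < n \<Longrightarrow> j \<noteq> i \<Longrightarrow> \<alpha> j = 0"
      by (auto simp: index_support_def)
    then have "\<alpha> = single_index n (i, \<alpha> i)"
      using \<alpha>(1) by (auto simp: single_index_def fun_eq_iff extensional_def)
    then show "\<alpha> \<in> single_index n ` ({..<n} \<times> (UNIV - {0}))"
      using i' by (intro image_eqI[of _ _ "(i, \<alpha> i)"]) auto
  qed
qed

text \<open>The basis function depends on \<open>x i\<close> alone, so \<open>f\<close> may be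
  replaced by its conditional expectation given that coordinate.\<close>

lemma cosine_coeff_single_index:
  assumes f: "bounded_rv n f" and i: "i < n" and k: "k \<noteq> 0"
  shows "cosine_coeff n f (single_index n (i, k)) = unit_coeff (marginal n i f) k"
proof -
  have basis: "cosine_basis n (single_index n (i, k)) = (\<lambda>x. cos_mode k (x i))"
    using index_support_single_index[OF i k] i k
    by (simp add: cosine_basis_def cos_mode_def single_index_def fun_eq_iff)
  have "(\<lambda>x. x i) \<in> measurable (unif_cube n) unif"
    unfolding unif_cube_eq using i by (intro measurable_component_singleton) simp
  moreover have "cos_mode k \<in> borel_measurable unif"
    by (intro borel_measurable_integrable integrable_unif_continuous continuous_intros)
  ultimately have "(\<lambda>x. cos_mode k (x i)) \<in> borel_measurable (unif_cube n)"
    by (rule measurable_compose)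
  moreover have "\<bar>cos_mode k t\<bar> \<le> sqrt 2" for t
    using mult_left_mono[OF abs_cos_le_one, of "sqrt 2" "pi * real k * t"] k
    by (simp add: cos_mode_def abs_mult)
  ultimately have "bounded_rv n (\<lambda>x. cos_mode k (x i))"
    by (intro bounded_rvI)
  then show ?thesis
    using integral_marginal_mult[OF f i, of "cos_mode k"] by (simp add: cosine_coeff_def basis unit_coeff_def)
qed

text \<open>The outer index set is finite: the induction adds one fibre over \<open>m\<close> at a
  time as a disjoint union.\<close>

lemma has_sum_lessThan_times:
  fixes h :: "nat \<times> 'b \<Rightarrow> real"
  assumes "\<And>i. i < m \<Longrightarrow> ((\<lambda>b. h (i, b)) has_sum s i) B"
  shows "(h has_sum (\<Sum>i<m. s i)) ({..<m} \<times> B)"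
  using assms
proof (induction m)
  case (Suc m)
  have "(h has_sum s m) (Pair m ` B)"
    using Suc.prems[of m] by (subst has_sum_reindex) (auto simp: inj_on_def comp_def)
  then have "(h has_sum ((\<Sum>i<m. s i) + s m)) (({..<m} \<times> B) \<union> (Pair m ` B))"
    using Suc by (intro has_sum_Un_disjoint) auto
  also have "({..<m} \<times> B) \<union> (Pair m ` B) = {..<Suc m} \<times> B"
    by (auto simp: lessThan_Suc)
  finally show ?case by simp
qed simp

text \<open>For each coordinate, Parseval for the two marginals without mode 0 gives the
  corresponding summand of \<open>level_part_1_inner\<close>.\<close>

lemma level_one_has_sum:
  assumes f: "continuous_on (cube n) f" "bounded_rv n f" and g: "continuous_on (cube n) g" "bounded_rv n g"
  shows "((\<lambda>\<alpha>. cosine_coeff n f \<alpha> * cosine_coeff n g \<alpha>) has_sum L2_inner n (level_part n 1 f) g) (level_one n)"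
proof -
  let ?h = "\<lambda>p. cosine_coeff n f (single_index n p) * cosine_coeff n g (single_index n p)"
  have "(?h has_sum (\<Sum>i<n. L2_inner n (avg n ({..<n} - {i}) f) g - expect n f * expect n g)) ({..<n} \<times> (UNIV - {0}))"
  proof (rule has_sum_lessThan_times)
    fix i assume i: "i < n"
    have "((\<lambda>k. unit_coeff (marginal n i f) k * unit_coeff (marginal n i g) k) has_sum
        (L2_inner n (avg n ({..<n} - {i}) f) g - expect n f * expect n g)) (UNIV - {0})"
      using parseval_nonconstant[OF continuous_on_marginal[OF f i] continuous_on_marginal[OF g i]]
        avg_inner_eq_marginals[OF f(2) g(2) i] integral_marginal[OF f(2) i] integral_marginal[OF g(2) i]
      by simp
    then show "((\<lambda>k. ?h (i, k)) has_sum
        (L2_inner n (avg n ({..<n} - {i}) f) g - expect n f * expect n g)) (UNIV - {0})"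
      by (rule has_sum_cong[THEN iffD1, rotated])
         (use i cosine_coeff_single_index[OF f(2) i] cosine_coeff_single_index[OF g(2) i] in auto)
  qed
  then show ?thesis
    unfolding level_part_1_inner[OF f(2) g(2)]
    by (subst has_sum_reindex_bij_betw[OF bij_betw_single_index, symmetric])
qed

section \<open>Conclusion\<close>

lemma neumann_class_continuous: "f \<in> neumann_class n \<Longrightarrow> continuous_on (cube n) f"
  unfolding neumann_class_def smooth_cube_def by (metis (mono_tags, lifting) C_k_cube.simps(1) mem_Collect_eq)

theorem theorem55:
  "\<exists>C::real. C > 0 \<and>
     (\<forall>n\<ge>1. \<forall>f g :: (nat \<Rightarrow> real) \<Rightarrow> real.
        monotone_cube n f \<longrightarrow> monotone_cube n g \<longrightarrow>
        f \<in> neumann_class n \<longrightarrow> g \<in> neumann_class n \<longrightarrow>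
        L2_norm n f \<le> 1 \<longrightarrow> L2_norm n g \<le> 1 \<longrightarrow>
        (\<exists>S. ((\<lambda>\<alpha>. cosine_coeff n f \<alpha> * cosine_coeff n g \<alpha>) has_sum S) (level_one n) \<and>
             S \<in> {0..1} \<and>
             expect n (\<lambda>x. f x * g x) - expect n f * expect n g \<ge> 1 / C * Phi S))"
\<comment> \<open>The constant is the one in \<open>Phi_le_of_endpoint_bounds\<close>.\<close>
proof (rule exI[of _ "16 * 31\<^sup>2"], intro conjI allI impI)
  fix n :: nat and f g :: "(nat \<Rightarrow> real) \<Rightarrow> real"
  assume n: "n \<ge> 1" and mono: "monotone_cube n f" "monotone_cube n g"
    and smooth: "f \<in> neumann_class n" "g \<in> neumann_class n"
    and norm: "L2_norm n f \<le> 1" "L2_norm n g \<le> 1"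
  have cont: "continuous_on (cube n) f" "continuous_on (cube n) g"
    using smooth by (auto intro: neumann_class_continuous)
  have f: "monotone_cube n f" "bounded_rv n f" and g: "monotone_cube n g" "bounded_rv n g"
    using mono cont by (auto intro: bounded_rv_monotone_continuous)
  have norm': "L2_inner n f f \<le> 1" "L2_inner n g g \<le> 1"
    using norm by (auto simp: L2_norm_def)
  define S where "S = L2_inner n (level_part n 1 f) g"
  \<comment> \<open>Monotonicity gives the lower bound and the norm bounds give the upper one, so S
    lies in the domain of \<open>Phi\<close>.\<close>
  have S: "0 \<le> S" "S \<le> 1"
    using level_one_nonneg[OF f g] abs_level_part_inner_le[OF f(2) g(2) norm', of 1] by (auto simp: S_def)
  have "Phi S \<le> 16 * 31\<^sup>2 * (L2_inner n f g - expect n f * expect n g)"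
    using S expect_mult_le[OF f g] level_one_le_covariance[OF f g norm' n]
    by (intro Phi_le_of_endpoint_bounds) (auto simp: S_def)
  then have "1 / (16 * 31\<^sup>2) * Phi S \<le> expect n (\<lambda>x. f x * g x) - expect n f * expect n g"
    by (simp add: L2_inner_def)
  then show "\<exists>S. ((\<lambda>\<alpha>. cosine_coeff n f \<alpha> * cosine_coeff n g \<alpha>) has_sum S) (level_one n) \<and>
      S \<in> {0..1} \<and> expect n (\<lambda>x. f x * g x) - expect n f * expect n g \<ge> 1 / (16 * 31\<^sup>2) * Phi S"
    using level_one_has_sum[OF cont(1) f(2) cont(2) g(2)] S by (intro exI[of _ S]) (auto simp: S_def)
qed simp

end
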